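(* Let $\nu=e^{-W}dx$ be a probability measure on $\mathbb{R}^d$ such that for all $x,y$ $$W(x+y)+W(x-y)-2W(x)\ge\delta(|y|)$$ with some non-negative increasing function $\delta:[0,\infty)\to[0,\infty)$. Then for every Borel set $A\subset\mathbb{R}^d$ and every $r>0$ $$\nu(A_r)\ge\Phi\Bigl(\Phi^{-1}(\nu(A))+\tfrac12\sqrt{\delta(r/8)}\Bigr).$$ In particular, if $\nu(A)\ge\frac12$, then for every $r>0$ $$\nu(A_r)\ge 1-\tfrac12\exp\Bigl(-\tfrac18\,\delta(r/8)\Bigr).$$
   Context: $|\cdot|$ is the Euclidean norm, $\Phi(t)=\frac{1}{\sqrt{2\pi}}\int_{-\infty}^te^{-s^2/2}ds$ (with $\Phi(-\infty)=0$, $\Phi(+\infty)=1$), and $A_r=\{y\in\mathbb{R}^d:|x-y|\le r\text{ for some }x\in A\}$. The measure $\nu$ has a convex support of positive Lebesgue measure and is log-concave, i.e. $W$ is convex (with $W=+\infty$ outside the support, the displayed inequality being required for $x$ with $W(x)<\infty$). *)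

theory Defs
  imports "HOL-Probability.Probability"
begin

text \<open>
  The standard normal distribution function on the extended line, with the improper integral as a
  Lebesgue interval integral; it takes the values 0 and 1 at the two infinite points.  It is a
  bijection from the extended reals onto \<^term>\<open>{0..1::real}\<close>, so that for \<open>p\<close> in that
  interval \<^term>\<open>inv std_normal_cdf p\<close> is the unique extended real with value \<open>p\<close>.
\<close>

definition std_normal_cdf :: "ereal \<Rightarrow> real" where
  "std_normal_cdf t = 1 / sqrt (2 * pi) * (LBINT s=-\<infinity>..t. exp (- (s\<^sup>2) / 2))"

lemma std_normal_cdf_minus_infinity: "std_normal_cdf (-\<infinity>) = 0"
  by (simp add: std_normal_cdf_def)

lemma std_normal_cdf_infinity: "std_normal_cdf \<infinity> = 1"
proof -
  have "(LBINT s=-\<infinity>..\<infinity>. exp (- (s\<^sup>2) / 2)) = sqrt (2 * pi) * (LINT s|lborel. std_normal_density s)"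
    by (simp add: interval_lebesgue_integral_def set_lebesgue_integral_def std_normal_density_def
      einterval_def)
  also have "(LINT s|lborel. std_normal_density s) = 1"
    by (rule integral_normal_density) simp
  finally show ?thesis
    by (simp add: std_normal_cdf_def)
qed

definition exp_uminus :: "ereal \<Rightarrow> ennreal" where
  "exp_uminus w =
    (case w of ereal u \<Rightarrow> ennreal (exp (- u)) | PInfty \<Rightarrow> 0 | MInfty \<Rightarrow> \<infinity>)"

text \<open>
  The reference measure is the completed one: the neighbourhood \<open>A_r\<close> of a Borel set \<open>A\<close>, taken with
  a non-strict inequality below, is Lebesgue measurable for \<open>r > 0\<close> but need not be Borel, and a
  convex function with values in the extended reals is Lebesgue but not always Borel measurable.
\<close>

definition exp_measure :: "('a::euclidean_space \<Rightarrow> ereal) \<Rightarrow> 'a measure" where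
  "exp_measure W = density lebesgue (\<lambda>x. exp_uminus (W x))"

definition neighbourhood :: "'a::real_normed_vector set \<Rightarrow> real \<Rightarrow> 'a set" where
  "neighbourhood A r = {y. \<exists>x\<in>A. norm (x - y) \<le> r}"

text \<open>
  Convexity of a function into \<open>(-\<infinity>, \<infinity>]\<close>: the points where it is finite form a convex set (part of
  \<^const>\<open>convex_on\<close>) on which it is convex as a real function.
\<close>

definition convex_ereal :: "('a::real_vector \<Rightarrow> ereal) \<Rightarrow> bool" where
  "convex_ereal W \<longleftrightarrow> (\<forall>x. W x \<noteq> -\<infinity>) \<and> convex_on {x. W x < \<infinity>} (\<lambda>x. real_of_ereal (W x))"

end

theory Submission
  imports Defs
begin

text \<open>
  For two compact sets at distance at least \<open>r\<close>, a localisation argument reduces the inequality to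
  dimension one.  Bisecting hyperplanes that leave the proportion of one set unchanged, and do not
  lower the proportion of the other one, cut a ball down to a convex body that is thin around a
  line.  By the Prekopa-Leindler inequality the marginal of the measure on that line inherits the
  modulus of convexity \<open>\<delta>\<close>.  On the line, let \<open>T\<close> be the increasing map that transports the
  standard Gaussian measure to the marginal, and let \<open>Q' = T\<close>.  At a maximum point of
  \<open>Q (z + t) + Q (z - t) - 2 Q z\<close> the modulus of convexity, applied to small intervals around
  \<open>T (z - t)\<close>, \<open>T z\<close> and \<open>T (z + t)\<close>, bounds the increments of \<open>T\<close>, which is the claim for half-lines;
  arbitrary compact subsets of the line follow because \<open>p \<mapsto> \<Phi> (\<Phi>\<inverse> p + k)\<close> is subadditive.
\<close>

section \<open>The Prekopa-Leindler inequality\<close>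

text \<open>Projection to a line does not keep two sets apart, which is why a body has to be thin
  before it is projected. It need not shrink to a segment: a loss of \<open>r / 4\<close> in
  distances is affordable, so finitely many cuts suffice and no limit of needles is taken. The
  projections are then \<open>3 * r / 4\<close> apart. On the line, comparing a second difference of
  \<open>Q\<close> with increments of \<open>T\<close> from both sides costs a factor 4 in the
  argument of \<delta>, and a strict inequality leaves room for windows of positive length. Applied
  with \<open>r / 2 < 3 * r / 4\<close>, this yields \<delta>(r/8). The marginal enters only through
  its distribution function, by inequalities between masses of intervals, so that neither its
  density nor a derivative of \<open>T\<close> is ever needed. Compact sets come first because their
  neighbourhoods are Borel and their projections are compact; inner regularity does the
  rest.\<close>

text \<open>Inner regularity is applied to a finite measure, hence the restriction to balls and the
  limit over their radius. The summand \<open>c\<close> is the measure of a second set, so that two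
  sets can be replaced by compact ones one after the other.\<close>

lemma emeasure_lborel_add_le_compactI:
  fixes B :: "'a::euclidean_space set" and c :: ennreal
  assumes B: "B \<in> sets borel"
    and le: "\<And>K. compact K \<Longrightarrow> K \<subseteq> B \<Longrightarrow> emeasure lborel K + c \<le> X"
  shows "emeasure lborel B + c \<le> X"
proof -
  have "emeasure lborel (B \<inter> cball 0 (real n)) + c \<le> X" for n :: nat
  proof -
    let ?C = "cball (0::'a) (real n)"
    let ?M = "density lborel (indicator ?C)"
    have em: "emeasure ?M S = emeasure lborel (S \<inter> ?C)" if "S \<in> sets borel" for S
    proof -
      have "emeasure ?M S = (\<integral>\<^sup>+ x. indicator ?C x * indicator S x \<partial>lborel)"
        using that by (intro emeasure_density) (auto intro!: borel_measurable_indicator)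
      also have "\<dots> = (\<integral>\<^sup>+ x. indicator (S \<inter> ?C) x \<partial>lborel)"
        by (intro nn_integral_cong) (simp split: split_indicator)
      finally have "emeasure ?M S = (\<integral>\<^sup>+ x. indicator (S \<inter> ?C) x \<partial>lborel)" .
      then show ?thesis using that by simp
    qed
    have "emeasure ?M B = (SUP K \<in> {K. K \<subseteq> B \<and> compact K}. emeasure ?M K)"
      using em[of UNIV] emeasure_lborel_cball_finite[of "0::'a" "real n"]
      by (intro inner_regular B) auto
    then have "emeasure ?M B + c = (SUP K \<in> {K. K \<subseteq> B \<and> compact K}. emeasure ?M K + c)"
      by (subst ennreal_SUP_add_left) auto
    also have "\<dots> \<le> X"
      by (rule SUP_least) (auto simp: em borel_compact compact_Int intro!: le)
    finally show ?thesis using em[OF B] by simp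
  qed
  then have "(SUP n. emeasure lborel (B \<inter> cball 0 (real n)) + c) \<le> X"
    by (rule SUP_least)
  moreover have "(SUP n. emeasure lborel (B \<inter> cball 0 (real n)) + c)
      = (SUP n. emeasure lborel (B \<inter> cball 0 (real n))) + c"
    by (rule ennreal_SUP_add_left) simp
  moreover have "(SUP n. emeasure lborel (B \<inter> cball 0 (real n))) = emeasure lborel (\<Union>n. B \<inter> cball 0 (real n))"
    using B by (intro SUP_emeasure_incseq) (auto simp: incseq_def)
  moreover have "(\<Union>n. B \<inter> cball 0 (real n)) = B"
    using real_arch_simple by auto
  ultimately show ?thesis by simp
qed

lemma emeasure_lborel_half_image:
  fixes P :: "real set"
  assumes "compact P"
  shows "2 * emeasure lborel ((\<lambda>x. (x + c) / 2) ` P) = emeasure lborel P"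
proof -
  let ?h = "\<lambda>x::real. c / 2 + (1 / 2) * x"
  have eq: "(\<lambda>x. (x + c) / 2) = ?h" by (auto simp: field_simps)
  have c: "compact (?h ` P)"
    by (intro compact_continuous_image assms continuous_intros)
  then have m: "?h ` P \<in> sets borel" by (rule borel_compact)
  have "emeasure lborel (?h ` P)
      = emeasure (density (distr lborel borel ?h) (\<lambda>_. ennreal \<bar>1/2\<bar>)) (?h ` P)"
    by (rule arg_cong[where f="\<lambda>M. emeasure M (?h ` P)", OF lborel_real_affine]) simp
  also have "\<dots> = ennreal (1/2) * emeasure lborel (?h -` ?h ` P)"
    using m by (simp add: emeasure_density nn_integral_cmult emeasure_distr)
  also have "?h -` ?h ` P = P"
    by (auto simp: inj_on_def)
  finally have *: "emeasure lborel (?h ` P) = ennreal (1/2) * emeasure lborel P" .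
  have "2 * ennreal (1/2) = ennreal (2 * (1/2))"
    by (subst ennreal_mult) simp_all
  then have "2 * ennreal (1/2) = 1" by simp
  then show ?thesis
    unfolding eq * by (metis mult.assoc mult_1)
qed

text \<open>Translate \<open>P\<close> by the least point of \<open>Q\<close>, translate
  \<open>Q\<close> by the greatest point of \<open>P\<close>, and halve both. The results lie in
  \<open>E\<close> and share at most one point, so their measures add up.\<close>

lemma brunn_minkowski_real_compact:
  fixes P Q E :: "real set"
  assumes P: "compact P" "P \<noteq> {}" and Q: "compact Q" "Q \<noteq> {}"
    and E: "E \<in> sets borel" and sub: "\<And>x y. x \<in> P \<Longrightarrow> y \<in> Q \<Longrightarrow> (x + y) / 2 \<in> E"
  shows "emeasure lborel P + emeasure lborel Q \<le> 2 * emeasure lborel E"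
proof -
  obtain s where s: "s \<in> P" "\<forall>x\<in>P. x \<le> s" using compact_attains_sup[OF P] by blast
  obtain i where i: "i \<in> Q" "\<forall>y\<in>Q. i \<le> y" using compact_attains_inf[OF Q] by blast
  let ?P = "(\<lambda>x. (x + i) / 2) ` P" and ?Q = "(\<lambda>y. (y + s) / 2) ` Q"
  have m: "?P \<in> sets borel" "?Q \<in> sets borel"
    using P Q by (auto intro!: borel_compact compact_continuous_image continuous_intros)
  have "?P \<inter> ?Q \<subseteq> {(s + i) / 2}"
  proof
    fix z assume "z \<in> ?P \<inter> ?Q"
    then obtain x y where xy: "x \<in> P" "z = (x + i) / 2" "y \<in> Q" "z = (y + s) / 2" by blast
    then have "x \<le> s" "i \<le> y" using s i by auto
    then show "z \<in> {(s + i) / 2}" using xy by simp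
  qed
  then have 0: "?P \<inter> ?Q \<in> null_sets lborel"
    by (rule countable_imp_null_set_lborel[OF countable_subset]) simp
  have "emeasure lborel P + emeasure lborel Q = 2 * (emeasure lborel ?P + emeasure lborel ?Q)"
    by (simp add: distrib_left emeasure_lborel_half_image P Q)
  also have "emeasure lborel ?P + emeasure lborel ?Q = emeasure lborel (?P \<union> ?Q)"
    using m by (intro emeasure_Un'[symmetric] 0) simp_all
  also have "\<dots> \<le> emeasure lborel E"
  proof (intro emeasure_mono)
    show "?P \<union> ?Q \<subseteq> E"
      using sub s(1) i(1) by (force simp: add.commute)
  qed (simp add: E)
  finally show ?thesis by (simp add: mult_left_mono)
qed

lemma brunn_minkowski_real:
  fixes P Q E :: "real set"
  assumes P: "P \<in> sets borel" "P \<noteq> {}" and Q: "Q \<in> sets borel" "Q \<noteq> {}"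
    and E: "E \<in> sets borel" and sub: "\<And>x y. x \<in> P \<Longrightarrow> y \<in> Q \<Longrightarrow> (x + y) / 2 \<in> E"
  shows "emeasure lborel P + emeasure lborel Q \<le> 2 * emeasure lborel E"
proof -
  obtain a b where ab: "a \<in> P" "b \<in> Q" using P Q by blast
  have "emeasure lborel K + emeasure lborel L \<le> 2 * emeasure lborel E"
    if "compact K" "K \<subseteq> P" "compact L" "L \<subseteq> Q" for K L
  proof -
    \<comment> \<open>The points \<open>a\<close> and \<open>b\<close> are inserted because the
      compact case asks for nonempty sets.\<close>
    have "emeasure lborel K + emeasure lborel L
        \<le> emeasure lborel (insert a K) + emeasure lborel (insert b L)"
      using that by (intro add_mono emeasure_mono) (auto simp: borel_compact compact_insert)
    also have "\<dots> \<le> 2 * emeasure lborel E"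
      using that ab by (intro brunn_minkowski_real_compact E sub) auto
    finally show ?thesis .
  qed
  then have "emeasure lborel P + emeasure lborel L \<le> 2 * emeasure lborel E"
    if "compact L" "L \<subseteq> Q" for L
    using that by (intro emeasure_lborel_add_le_compactI[OF P(1)]) auto
  then show ?thesis
    using emeasure_lborel_add_le_compactI[OF Q(1)] by (metis add.commute)
qed

lemma nn_integral_layer_cake:
  fixes u :: "real \<Rightarrow> real"
  assumes [measurable]: "u \<in> borel_measurable borel" and nonneg: "\<And>x. 0 \<le> u x"
  shows "(\<integral>\<^sup>+ x. ennreal (u x) \<partial>lborel) = (\<integral>\<^sup>+ c. emeasure lborel {x. 0 < c \<and> c < u x} \<partial>lborel)"
proof -
  have "(\<integral>\<^sup>+ x. ennreal (u x) \<partial>lborel)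
      = (\<integral>\<^sup>+ x. (\<integral>\<^sup>+ c. indicator {p. 0 < snd p \<and> snd p < u (fst p)} (x, c) \<partial>lborel) \<partial>lborel)"
  proof (intro nn_integral_cong)
    fix x
    have "(\<integral>\<^sup>+ c. indicator {p. 0 < snd p \<and> snd p < u (fst p)} (x, c) \<partial>lborel)
        = (\<integral>\<^sup>+ c. indicator {0<..<u x} c \<partial>lborel)"
      by (intro nn_integral_cong) (simp split: split_indicator)
    then show "ennreal (u x) = (\<integral>\<^sup>+ c. indicator {p. 0 < snd p \<and> snd p < u (fst p)} (x, c) \<partial>lborel)"
      using nonneg[of x] by simp
  qed
  also have "\<dots> = (\<integral>\<^sup>+ c. (\<integral>\<^sup>+ x. indicator {p. 0 < snd p \<and> snd p < u (fst p)} (x, c) \<partial>lborel) \<partial>lborel)"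
    by (rule lborel_pair.Fubini'[symmetric]) measurable
  also have "\<dots> = (\<integral>\<^sup>+ c. emeasure lborel {x. 0 < c \<and> c < u x} \<partial>lborel)"
  proof (intro nn_integral_cong)
    fix c
    have "(\<integral>\<^sup>+ x. indicator {p. 0 < snd p \<and> snd p < u (fst p)} (x, c) \<partial>lborel)
        = (\<integral>\<^sup>+ x. indicator {x. 0 < c \<and> c < u x} x \<partial>lborel)"
      by (intro nn_integral_cong) (simp split: split_indicator)
    also have "\<dots> = emeasure lborel {x. 0 < c \<and> c < u x}"
      by (rule nn_integral_indicator) measurable
    finally show "(\<integral>\<^sup>+ x. indicator {p. 0 < snd p \<and> snd p < u (fst p)} (x, c) \<partial>lborel)
        = emeasure lborel {x. 0 < c \<and> c < u x}" .
  qed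
  finally show ?thesis .
qed

text \<open>Brunn-Minkowski for the superlevel sets, integrated over the level. It needs both
  superlevel sets to be nonempty, which is guaranteed for every level below 1 because
  \<open>u\<close> and \<open>v\<close> have the same supremum 1; levels from 1 on contribute
  nothing on the left.\<close>

lemma prekopa_leindler_real_sup1:
  fixes u v w :: "real \<Rightarrow> real"
  assumes [measurable]: "u \<in> borel_measurable borel" "v \<in> borel_measurable borel"
      "w \<in> borel_measurable borel"
    and u: "\<And>x. 0 \<le> u x" "\<And>x. u x \<le> 1" "\<And>c. c < 1 \<Longrightarrow> \<exists>x. c < u x"
    and v: "\<And>x. 0 \<le> v x" "\<And>x. v x \<le> 1" "\<And>c. c < 1 \<Longrightarrow> \<exists>x. c < v x"
    and w: "\<And>x. 0 \<le> w x"
    and uvw: "\<And>c x y. 0 < c \<Longrightarrow> c < 1 \<Longrightarrow> c < u x \<Longrightarrow> c < v y \<Longrightarrow> c < w ((x + y) / 2)"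
  shows "(\<integral>\<^sup>+ x. ennreal (u x) \<partial>lborel) + (\<integral>\<^sup>+ x. ennreal (v x) \<partial>lborel)
    \<le> 2 * (\<integral>\<^sup>+ x. ennreal (w x) \<partial>lborel)"
proof -
  have m: "(\<lambda>c. emeasure lborel {x. 0 < c \<and> c < f x}) \<in> borel_measurable lborel"
    if [measurable]: "f \<in> borel_measurable borel" for f :: "real \<Rightarrow> real"
  proof -
    have "{p \<in> space (borel \<Otimes>\<^sub>M borel). 0 < fst p \<and> fst p < f (snd p)} \<in> sets (borel \<Otimes>\<^sub>M borel)"
      by measurable
    then have "{p. 0 < fst p \<and> fst p < f (snd p)} \<in> sets (lborel \<Otimes>\<^sub>M lborel)"
      by (simp add: space_pair_measure cong: sets_pair_measure_cong)
    then have "(\<lambda>c. emeasure lborel (Pair c -` {p. 0 < fst p \<and> fst p < f (snd p)})) \<in> borel_measurable lborel"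
      by (rule lborel.measurable_emeasure_Pair)
    then show ?thesis by (simp add: vimage_def)
  qed
  have "emeasure lborel {x. 0 < c \<and> c < u x} + emeasure lborel {x. 0 < c \<and> c < v x}
      \<le> 2 * emeasure lborel {x. 0 < c \<and> c < w x}" for c
  proof (cases "0 < c \<and> c < 1")
    case True
    have "{x. c < u x} \<in> sets borel" "{x. c < v x} \<in> sets borel" "{x. c < w x} \<in> sets borel"
      by measurable
    with True u(3)[of c] v(3)[of c] uvw[of c] show ?thesis
      by (simp, intro brunn_minkowski_real) auto
  next
    case False
    then have "{x. 0 < c \<and> c < u x} = {}" "{x. 0 < c \<and> c < v x} = {}"
      using u(2) v(2) by (auto simp: not_less) (meson leD le_less_trans order_trans)+
    then show ?thesis by (simp only: emeasure_empty) simp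
  qed
  then have "(\<integral>\<^sup>+ c. emeasure lborel {x. 0 < c \<and> c < u x} + emeasure lborel {x. 0 < c \<and> c < v x} \<partial>lborel)
      \<le> (\<integral>\<^sup>+ c. 2 * emeasure lborel {x. 0 < c \<and> c < w x} \<partial>lborel)"
    by (intro nn_integral_mono)
  then show ?thesis
    by (simp add: nn_integral_layer_cake u v w nn_integral_add nn_integral_cmult m)
qed

text \<open>Dividing \<open>f\<close> and \<open>g\<close> by their suprema \<open>a\<close> and
  \<open>b\<close>, and \<open>h\<close> by \<open>sqrt (a * b)\<close>, reduces the claim to the
  additive inequality for suprema equal to 1. The arithmetic-geometric mean inequality turns the sum
  of the integrals back into a product.\<close>

lemma prekopa_leindler_real_bounded:
  fixes f g :: "real \<Rightarrow> real" and h :: "real \<Rightarrow> ennreal"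
  assumes m[measurable]: "f \<in> borel_measurable borel" "g \<in> borel_measurable borel"
      "h \<in> borel_measurable borel"
    and f: "\<And>x. 0 \<le> f x" "bdd_above (range f)"
    and g: "\<And>x. 0 \<le> g x" "bdd_above (range g)"
    and fgh: "\<And>x y. ennreal (f x * g y) \<le> (h ((x + y) / 2))\<^sup>2"
  shows "(\<integral>\<^sup>+ x. ennreal (f x) \<partial>lborel) * (\<integral>\<^sup>+ x. ennreal (g x) \<partial>lborel) \<le> (\<integral>\<^sup>+ x. h x \<partial>lborel)\<^sup>2"
proof (cases "(\<forall>x. f x = 0) \<or> (\<forall>x. g x = 0) \<or> (\<integral>\<^sup>+ x. h x \<partial>lborel) = \<infinity>")
  case True
  then show ?thesis by (auto simp: power2_eq_square ennreal_mult_eq_top_iff)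
next
  case False
  define a b where "a = (SUP x. f x)" and "b = (SUP x. g x)"
  have fa: "f x \<le> a" and gb: "g x \<le> b" for x
    unfolding a_def b_def using f g by (auto intro: cSUP_upper)
  have a: "0 < a" and b: "0 < b"
    using False f(1) g(1) fa gb by (metis order_le_less order_less_le_trans)+
  define s where "s = sqrt (a * b)"
  have s: "0 < s" using a b by (simp add: s_def)
  \<comment> \<open>Only levels below 1 occur, so truncation at 1 loses nothing and makes
    \<open>w\<close> real valued.\<close>
  define w where "w x = enn2real (min 1 (h x / ennreal s))" for x
  have [measurable]: "w \<in> borel_measurable borel" unfolding w_def by measurable
  have w: "ennreal (w x) = min 1 (h x / ennreal s)" for x
    unfolding w_def by (subst ennreal_enn2real) (auto simp: min_less_iff_disj)
  have ab: "\<exists>x. c < f x / a" "\<exists>x. c < g x / b" if "c < 1" for c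
  proof -
    have "\<exists>x. c * a < f x" using that a f(2) unfolding a_def
      by (subst less_cSUP_iff[symmetric, of UNIV, simplified]) auto
    then show "\<exists>x. c < f x / a" using a by (simp add: field_simps)
    have "\<exists>x. c * b < g x" using that b g(2) unfolding b_def
      by (subst less_cSUP_iff[symmetric, of UNIV, simplified]) auto
    then show "\<exists>x. c < g x / b" using b by (simp add: field_simps)
  qed
  have fgw: "c < w ((x + y) / 2)" if c: "0 < c" "c < 1" and "c < f x / a" "c < g y / b" for c x y
  proof -
    have "c * a < f x" "c * b < g y" using that a b by (simp_all add: field_simps)
    then have "(c * a) * (c * b) < f x * g y"
      using c a b by (intro mult_strict_mono) (auto intro: less_trans[of 0 "c * a"])
    also have "(c * a) * (c * b) = (c * s)\<^sup>2" using a b by (simp add: s_def power_mult_distrib power2_eq_square)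
    finally have "ennreal ((c * s)\<^sup>2) < ennreal (f x * g y)"
      by (intro ennreal_lessI) (use f(1)[of x] g(1)[of y] in \<open>auto intro: le_less_trans[of _ "(c * s)\<^sup>2"]\<close>)
    also have "\<dots> \<le> (h ((x + y) / 2))\<^sup>2" by (rule fgh)
    finally have "(ennreal (c * s))\<^sup>2 < (h ((x + y) / 2))\<^sup>2" using c s by (simp add: ennreal_power)
    then have "ennreal (c * s) < h ((x + y) / 2)"
      by (metis power_mono not_less zero_le)
    then have "ennreal c < h ((x + y) / 2) / ennreal s"
      using c s by (cases "h ((x + y) / 2)")
        (auto simp: divide_ennreal ennreal_less_iff field_simps ennreal_top_divide)
    then have "ennreal c < ennreal (w ((x + y) / 2))"
      using c by (simp add: w)
    then show ?thesis using c by (simp add: ennreal_less_iff)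
  qed
  have "(\<integral>\<^sup>+ x. ennreal (f x / a) \<partial>lborel) + (\<integral>\<^sup>+ x. ennreal (g x / b) \<partial>lborel)
    \<le> 2 * (\<integral>\<^sup>+ x. ennreal (w x) \<partial>lborel)"
    using a b f(1) g(1) fa gb ab fgw
    by (intro prekopa_leindler_real_sup1) (auto simp: w_def)
  also have "(\<integral>\<^sup>+ x. ennreal (w x) \<partial>lborel) \<le> (\<integral>\<^sup>+ x. h x / ennreal s \<partial>lborel)"
    by (intro nn_integral_mono) (simp add: w)
  also have "\<dots> = (\<integral>\<^sup>+ x. h x \<partial>lborel) / ennreal s"
    by (rule nn_integral_divide) simp
  finally have *: "(\<integral>\<^sup>+ x. ennreal (f x / a) \<partial>lborel) + (\<integral>\<^sup>+ x. ennreal (g x / b) \<partial>lborel)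
    \<le> 2 * ((\<integral>\<^sup>+ x. h x \<partial>lborel) / ennreal s)" by (simp add: mult_left_mono)
  obtain H where H: "(\<integral>\<^sup>+ x. h x \<partial>lborel) = ennreal H" "0 \<le> H"
    using False by (cases "\<integral>\<^sup>+ x. h x \<partial>lborel") auto
  have F: "(\<integral>\<^sup>+ x. ennreal (f x) \<partial>lborel) = ennreal a * (\<integral>\<^sup>+ x. ennreal (f x / a) \<partial>lborel)"
    using a f(1) by (subst nn_integral_cmult[symmetric]) (auto simp flip: ennreal_mult)
  have G: "(\<integral>\<^sup>+ x. ennreal (g x) \<partial>lborel) = ennreal b * (\<integral>\<^sup>+ x. ennreal (g x / b) \<partial>lborel)"
    using b g(1) by (subst nn_integral_cmult[symmetric]) (auto simp flip: ennreal_mult)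
  have fin: "2 * (ennreal H / ennreal s) = ennreal (2 * (H / s))"
    using s H ennreal_mult[of 2 "H / s"] by (simp add: divide_ennreal)
  from * have "(\<integral>\<^sup>+ x. ennreal (f x / a) \<partial>lborel) + (\<integral>\<^sup>+ x. ennreal (g x / b) \<partial>lborel) < \<infinity>"
    unfolding H fin by (rule le_less_trans) simp
  then obtain X Y where X: "(\<integral>\<^sup>+ x. ennreal (f x / a) \<partial>lborel) = ennreal X" "0 \<le> X"
    and Y: "(\<integral>\<^sup>+ x. ennreal (g x / b) \<partial>lborel) = ennreal Y" "0 \<le> Y"
    by (cases "\<integral>\<^sup>+ x. ennreal (f x / a) \<partial>lborel"; cases "\<integral>\<^sup>+ x. ennreal (g x / b) \<partial>lborel") auto
  from * have "X + Y \<le> 2 * (H / s)"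
    unfolding H fin X Y using X Y H s by (simp flip: ennreal_plus)
  then have "s * (X + Y) \<le> 2 * H" using s by (simp add: field_simps)
  then have "(s * (X + Y))\<^sup>2 \<le> (2 * H)\<^sup>2" using s X Y by (intro power_mono) auto
  moreover have "4 * (a * b * (X * Y)) \<le> (s * (X + Y))\<^sup>2"
  proof -
    have "4 * (X * Y) \<le> (X + Y)\<^sup>2"
      using zero_le_power2[of "X - Y"] by (simp add: power2_eq_square algebra_simps)
    then have "a * b * (4 * (X * Y)) \<le> a * b * (X + Y)\<^sup>2"
      using a b by (intro mult_left_mono) auto
    then show ?thesis using a b by (simp add: s_def power_mult_distrib mult_ac)
  qed
  ultimately have "(a * X) * (b * Y) \<le> H\<^sup>2" by (simp add: power_mult_distrib algebra_simps)
  then show ?thesis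
    unfolding F G H X Y using a b X Y H by (simp add: ennreal_power flip: ennreal_mult)
qed

lemma SUP_min_of_nat_ennreal: "(SUP n. min a (of_nat n)) = (a :: ennreal)"
  using inf_SUP[of a "of_nat :: nat \<Rightarrow> ennreal" UNIV] by (simp add: inf_min ennreal_SUP_of_nat_eq_top)

lemma nn_integral_SUP_min_of_nat:
  fixes f :: "'a \<Rightarrow> ennreal"
  assumes [measurable]: "f \<in> borel_measurable M"
  shows "(\<integral>\<^sup>+ x. f x \<partial>M) = (SUP n. \<integral>\<^sup>+ x. min (f x) (of_nat n) \<partial>M)"
proof -
  have "(\<integral>\<^sup>+ x. f x \<partial>M) = (\<integral>\<^sup>+ x. (SUP n. min (f x) (of_nat n)) \<partial>M)"
    by (simp add: SUP_min_of_nat_ennreal)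
  also have "\<dots> = (SUP n. \<integral>\<^sup>+ x. min (f x) (of_nat n) \<partial>M)"
    by (intro nn_integral_monotone_convergence_SUP)
       (auto simp: incseq_def le_fun_def min_le_iff_disj intro: min.mono)
  finally show ?thesis .
qed

lemma prekopa_leindler_real:
  fixes f g h :: "real \<Rightarrow> ennreal"
  assumes [measurable]: "f \<in> borel_measurable borel" "g \<in> borel_measurable borel"
      "h \<in> borel_measurable borel"
    and fgh: "\<And>x y. f x * g y \<le> (h ((x + y) / 2))\<^sup>2"
  shows "(\<integral>\<^sup>+ x. f x \<partial>lborel) * (\<integral>\<^sup>+ x. g x \<partial>lborel) \<le> (\<integral>\<^sup>+ x. h x \<partial>lborel)\<^sup>2"
proof -
  have "(\<integral>\<^sup>+ x. min (f x) (of_nat n) \<partial>lborel) * (\<integral>\<^sup>+ x. min (g x) (of_nat m) \<partial>lborel)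
      \<le> (\<integral>\<^sup>+ x. h x \<partial>lborel)\<^sup>2" for n m
  proof -
    define F G where "F x = enn2real (min (f x) (of_nat n))" and "G x = enn2real (min (g x) (of_nat m))" for x
    have F: "ennreal (F x) = min (f x) (of_nat n)" and G: "ennreal (G x) = min (g x) (of_nat m)" for x
      unfolding F_def G_def
      by (intro ennreal_enn2real; metis min.cobounded2 of_nat_less_top le_less_trans)+
    have F0: "0 \<le> F x" and G0: "0 \<le> G x" for x
      unfolding F_def G_def by simp_all
    have Fn: "F x \<le> real n" and Gm: "G x \<le> real m" for x
      unfolding F_def G_def by (auto intro!: enn2real_leI simp: ennreal_of_nat_eq_real_of_nat)
    have "(\<integral>\<^sup>+ x. ennreal (F x) \<partial>lborel) * (\<integral>\<^sup>+ x. ennreal (G x) \<partial>lborel) \<le> (\<integral>\<^sup>+ x. h x \<partial>lborel)\<^sup>2"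
    proof (rule prekopa_leindler_real_bounded)
      show "F \<in> borel_measurable borel" "G \<in> borel_measurable borel"
        unfolding F_def G_def by measurable
      show "bdd_above (range F)" "bdd_above (range G)" using Fn Gm by (auto intro!: bdd_aboveI)
      fix x y
      have "ennreal (F x * G y) = min (f x) (of_nat n) * min (g y) (of_nat m)"
        using ennreal_mult[of "F x" "G y"] F0 G0 by (simp add: F G)
      also have "\<dots> \<le> f x * g y" by (intro mult_mono) auto
      also have "\<dots> \<le> (h ((x + y) / 2))\<^sup>2" by (rule fgh)
      finally show "ennreal (F x * G y) \<le> (h ((x + y) / 2))\<^sup>2" .
    qed (auto simp: F0 G0)
    then show ?thesis by (simp add: F G)
  qed
  then show ?thesis
    by (subst (1 2) nn_integral_SUP_min_of_nat)
       (auto simp: SUP_mult_left_ennreal SUP_mult_right_ennreal intro!: SUP_least)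
qed

section \<open>Prekopa-Leindler in several dimensions by induction on the coordinates\<close>

text \<open>Fix one coordinate as \<open>t\<close>, \<open>s\<close> and \<open>(t + s) / 2\<close>
  in the three functions: the induction hypothesis for these sections says that the integrals over
  the other coordinates satisfy the one-dimensional hypothesis. The restriction of the midpoint to
  \<open>I\<close> is there because points of the product space are extensional.\<close>

lemma prekopa_leindler_PiM:
  fixes f g h :: "('i \<Rightarrow> real) \<Rightarrow> ennreal"
  assumes "finite I"
    and "f \<in> borel_measurable (Pi\<^sub>M I (\<lambda>_. lborel))" "g \<in> borel_measurable (Pi\<^sub>M I (\<lambda>_. lborel))"
      "h \<in> borel_measurable (Pi\<^sub>M I (\<lambda>_. lborel))"
    and "\<And>x y. f x * g y \<le> (h (\<lambda>k\<in>I. (x k + y k) / 2))\<^sup>2"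
  shows "(\<integral>\<^sup>+ x. f x \<partial>Pi\<^sub>M I (\<lambda>_. lborel)) * (\<integral>\<^sup>+ x. g x \<partial>Pi\<^sub>M I (\<lambda>_. lborel))
    \<le> (\<integral>\<^sup>+ x. h x \<partial>Pi\<^sub>M I (\<lambda>_. lborel))\<^sup>2"
  using assms
proof (induction I arbitrary: f g h rule: finite_induct)
  case empty
  interpret product_sigma_finite "\<lambda>_. lborel :: real measure" by standard
  show ?case using empty(4)[of "\<lambda>_. undefined" "\<lambda>_. undefined"]
    by (simp add: nn_integral_empty)
next
  case (insert i I)
  interpret product_sigma_finite "\<lambda>_. lborel :: real measure" by standard
  interpret finite_product_sigma_finite "\<lambda>_. lborel :: real measure" I by standard (rule insert)
  have meas: "(\<lambda>p. u ((snd p)(i := fst p))) \<in> borel_measurable (borel \<Otimes>\<^sub>M Pi\<^sub>M I (\<lambda>_. lborel))"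
    if [measurable]: "u \<in> borel_measurable (Pi\<^sub>M (insert i I) (\<lambda>_. lborel))" for u :: "('i \<Rightarrow> real) \<Rightarrow> ennreal"
    by measurable
  have sec: "(\<lambda>x. u (x(i := t))) \<in> borel_measurable (Pi\<^sub>M I (\<lambda>_. lborel))"
    if "u \<in> borel_measurable (Pi\<^sub>M (insert i I) (\<lambda>_. lborel))" for u :: "('i \<Rightarrow> real) \<Rightarrow> ennreal" and t
    using measurable_compose[OF measurable_Pair1' meas[OF that], of t] by simp
  have int: "(\<lambda>t. \<integral>\<^sup>+ x. u (x(i := t)) \<partial>Pi\<^sub>M I (\<lambda>_. lborel)) \<in> borel_measurable borel"
    if "u \<in> borel_measurable (Pi\<^sub>M (insert i I) (\<lambda>_. lborel))" for u :: "('i \<Rightarrow> real) \<Rightarrow> ennreal"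
    using borel_measurable_nn_integral_fst[OF meas[OF that]] by simp
  have "(\<integral>\<^sup>+ x. f (x(i := t)) \<partial>Pi\<^sub>M I (\<lambda>_. lborel)) * (\<integral>\<^sup>+ x. g (x(i := s)) \<partial>Pi\<^sub>M I (\<lambda>_. lborel))
      \<le> (\<integral>\<^sup>+ x. h (x(i := (t + s) / 2)) \<partial>Pi\<^sub>M I (\<lambda>_. lborel))\<^sup>2" for t s
  proof (rule insert.IH)
    fix x y :: "'i \<Rightarrow> real"
    have eq: "(\<lambda>k\<in>insert i I. ((x(i := t)) k + (y(i := s)) k) / 2) = (\<lambda>k\<in>I. (x k + y k) / 2)(i := (t + s) / 2)"
      using insert.hyps by (auto simp: fun_eq_iff)
    show "f (x(i := t)) * g (y(i := s)) \<le> (h ((\<lambda>k\<in>I. (x k + y k) / 2)(i := (t + s) / 2)))\<^sup>2"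
      unfolding eq[symmetric] by (rule insert.prems(4))
  qed (rule sec, rule insert.prems)+
  then show ?case
    unfolding product_nn_integral_insert_rev[OF insert.hyps insert.prems(1)]
      product_nn_integral_insert_rev[OF insert.hyps insert.prems(2)]
      product_nn_integral_insert_rev[OF insert.hyps insert.prems(3)]
    by (intro prekopa_leindler_real int insert.prems)
qed

theorem prekopa_leindler:
  fixes f g h :: "'a::euclidean_space \<Rightarrow> ennreal"
  assumes [measurable]: "f \<in> borel_measurable borel" "g \<in> borel_measurable borel"
      "h \<in> borel_measurable borel"
    and fgh: "\<And>x y. f x * g y \<le> (h ((x + y) /\<^sub>R 2))\<^sup>2"
  shows "(\<integral>\<^sup>+ x. f x \<partial>lborel) * (\<integral>\<^sup>+ x. g x \<partial>lborel) \<le> (\<integral>\<^sup>+ x. h x \<partial>lborel)\<^sup>2"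
proof -
  let ?v = "\<lambda>x :: 'a \<Rightarrow> real. \<Sum>b\<in>Basis. x b *\<^sub>R b"
  have v[measurable]: "?v \<in> borel_measurable (Pi\<^sub>M Basis (\<lambda>_. lborel))" by measurable
  have int: "(\<integral>\<^sup>+ x. u x \<partial>lborel) = (\<integral>\<^sup>+ x. u (?v x) \<partial>Pi\<^sub>M Basis (\<lambda>_. lborel))"
    if [measurable]: "u \<in> borel_measurable borel" for u :: "'a \<Rightarrow> ennreal"
    by (subst lborel_def) (simp add: nn_integral_distr lborel_eq_real[symmetric])
  show ?thesis
    unfolding int[OF assms(1)] int[OF assms(2)] int[OF assms(3)]
  proof (rule prekopa_leindler_PiM)
    fix x y :: "'a \<Rightarrow> real"
    have "?v (\<lambda>k\<in>Basis. (x k + y k) / 2) = (\<Sum>b\<in>Basis. inverse 2 *\<^sub>R (x b *\<^sub>R b + y b *\<^sub>R b))"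
    proof (intro sum.cong refl)
      fix b :: 'a assume "b \<in> Basis"
      then have "(\<lambda>k\<in>Basis. (x k + y k) / 2) b = inverse 2 * (x b + y b)" by simp
      then show "(\<lambda>k\<in>Basis. (x k + y k) / 2) b *\<^sub>R b = inverse 2 *\<^sub>R (x b *\<^sub>R b + y b *\<^sub>R b)"
        by (simp only: scaleR_scaleR[symmetric] scaleR_add_left)
    qed
    also have "\<dots> = (?v x + ?v y) /\<^sub>R 2"
      by (simp only: sum.distrib[symmetric] scaleR_sum_right)
    finally show "f (?v x) * g (?v y) \<le> (h (?v (\<lambda>k\<in>Basis. (x k + y k) / 2)))\<^sup>2"
      using fgh[of "?v x" "?v y"] by simp
  qed measurable
qed

section \<open>The Gaussian distribution function\<close>

text \<open>The restriction of \<Phi> to finite arguments, taken as a \<open>cdf\<close> so that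
  limits come from the general theory; \<open>std_normal_cdf_ereal\<close> identifies the
  two.\<close>

definition gcdf :: "real \<Rightarrow> real" where
  "gcdf = cdf std_normal_distribution"

lemma gcdf_diff: 
  assumes "a \<le> z"
  shows "gcdf z - gcdf a = integral {a..z} std_normal_density"
proof -
  interpret real_distribution std_normal_distribution
    by (rule real_dist_normal_dist)
  have i: "integrable lborel std_normal_density" by simp
  have "gcdf z - gcdf a = measure std_normal_distribution {a<..z}"
    unfolding gcdf_def using assms cdf_diff_eq[of a z] by (cases "a = z") auto
  also have "\<dots> = (LINT x|lborel. indicator {a<..z} x * std_normal_density x)"
  proof -
    have "emeasure std_normal_distribution {a<..z}
        = (\<integral>\<^sup>+ x. ennreal (indicator {a<..z} x * std_normal_density x) \<partial>lborel)"
      by (subst emeasure_density) (auto intro!: nn_integral_cong split: split_indicator)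
    also have "\<dots> = ennreal (LINT x|lborel. indicator {a<..z} x * std_normal_density x)"
      using integrable_real_mult_indicator[OF _ i, of "{a<..z}"]
      by (intro nn_integral_eq_integral) (auto simp: mult.commute)
    finally show ?thesis by (simp add: measure_def integral_nonneg_AE)
  qed
  also have "\<dots> = (LINT x:{a<..z}|lborel. std_normal_density x)"
    by (simp add: set_lebesgue_integral_def)
  also have "\<dots> = integral {a<..z} std_normal_density"
    by (intro set_borel_integral_eq_integral(2))
      (use integrable_mult_indicator[OF _ i, of "{a<..z}"] in \<open>simp add: set_integrable_def\<close>)
  also have "\<dots> = integral {a..z} std_normal_density"
    by (intro integral_spike_set) (auto intro: negligible_subset[of "{a}"])
  finally show ?thesis .
qed

lemma gcdf_has_real_derivative: "(gcdf has_real_derivative std_normal_density z) (at z)"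
proof -
  have c: "continuous_on S std_normal_density" for S
    unfolding std_normal_density_def by (intro continuous_intros) auto
  have "((\<lambda>x. integral {z - 1..x} std_normal_density) has_real_derivative std_normal_density z)
      (at z within {z - 1..z + 1})"
    by (intro integral_has_real_derivative c) auto
  then have "((\<lambda>x. integral {z - 1..x} std_normal_density) has_real_derivative std_normal_density z) (at z)"
    by (subst (asm) at_within_interior) auto
  then have "((\<lambda>x. gcdf (z - 1) + integral {z - 1..x} std_normal_density) has_real_derivative std_normal_density z) (at z)"
    by (auto intro!: derivative_eq_intros)
  then show ?thesis
  proof (rule has_field_derivative_transform_within_open[where S="{z - 1<..}"])
    show "gcdf (z - 1) + integral {z - 1..x} std_normal_density = gcdf x" if "x \<in> {z - 1<..}" for x
      using gcdf_diff[of "z - 1" x] that by simp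
  qed auto
qed

lemma gcdf_at_bot: "(gcdf \<longlongrightarrow> 0) at_bot" and gcdf_at_top: "(gcdf \<longlongrightarrow> 1) at_top"
proof -
  interpret real_distribution std_normal_distribution
    by (rule real_dist_normal_dist)
  show "(gcdf \<longlongrightarrow> 0) at_bot" "(gcdf \<longlongrightarrow> 1) at_top"
    unfolding gcdf_def by (rule cdf_lim_at_bot cdf_lim_at_top_prob)+
qed

lemma gcdf_strict_mono: "a < b \<Longrightarrow> gcdf a < gcdf b"
  by (rule DERIV_pos_imp_increasing[of a b gcdf])
    (auto intro!: exI gcdf_has_real_derivative normal_density_pos)

lemma gcdf_less_iff [simp]: "gcdf a < gcdf b \<longleftrightarrow> a < b"
  using gcdf_strict_mono by (metis less_asym' linorder_less_linear)

lemma gcdf_le_iff [simp]: "gcdf a \<le> gcdf b \<longleftrightarrow> a \<le> b"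
  by (simp add: not_less[symmetric])

lemma gcdf_inject [simp]: "gcdf a = gcdf b \<longleftrightarrow> a = b"
  by (simp add: order_eq_iff)

lemma gcdf_pos [simp]: "0 < gcdf z"
proof -
  have "0 \<le> gcdf (z - 1)"
    by (simp add: gcdf_def cdf_def)
  also have "gcdf (z - 1) < gcdf z" by simp
  finally show ?thesis .
qed

lemma gcdf_less_1 [simp]: "gcdf z < 1"
proof -
  interpret real_distribution std_normal_distribution
    by (rule real_dist_normal_dist)
  have "gcdf (z + 1) \<le> 1"
    unfolding gcdf_def cdf_def by (rule prob_le_1)
  moreover have "gcdf z < gcdf (z + 1)" by simp
  ultimately show ?thesis by linarith
qed

lemma isCont_gcdf: "isCont gcdf z"
  using gcdf_has_real_derivative DERIV_isCont by blast

lemma continuous_on_gcdf: "continuous_on S gcdf"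
  by (simp add: continuous_at_imp_continuous_on isCont_gcdf)

lemma gcdf_surj:
  assumes "0 < p" "p < 1"
  obtains z where "gcdf z = p"
proof -
  obtain a where a: "gcdf a < p"
    using eventually_happens[OF order_tendstoD(2)[OF gcdf_at_bot assms(1)]] by auto
  obtain b where b: "p < gcdf b"
    using eventually_happens[OF order_tendstoD(1)[OF gcdf_at_top assms(2)]] by auto
  have "a \<le> b" using a b by (metis gcdf_le_iff less_le_trans less_imp_le)
  then show ?thesis
    using IVT'[of gcdf a p b] a b that by (auto simp: continuous_on_gcdf)
qed

lemma gcdf_minus: "gcdf (- z) = 1 - gcdf z"
proof -
  have "((\<lambda>z. gcdf z + gcdf (- z)) has_real_derivative 0) (at z)" for z
    using DERIV_add[OF gcdf_has_real_derivative
        DERIV_chain2[OF gcdf_has_real_derivative DERIV_minus[OF DERIV_ident]], of z]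
    by (simp add: std_normal_density_def)
  then have const: "gcdf x + gcdf (- x) = gcdf z + gcdf (- z)" for x
    using DERIV_isconst_all[of "\<lambda>z. gcdf z + gcdf (- z)" x z] by blast
  have "((\<lambda>x. gcdf x + gcdf (- x)) \<longlongrightarrow> 1 + 0) at_top"
    by (intro tendsto_add gcdf_at_top filterlim_compose[OF gcdf_at_bot] filterlim_uminus_at_bot_at_top)
  moreover have "(\<lambda>x. gcdf x + gcdf (- x)) = (\<lambda>_. gcdf z + gcdf (- z))"
    using const by blast
  ultimately have "((\<lambda>_. gcdf z + gcdf (- z)) \<longlongrightarrow> 1 + 0) (at_top :: real filter)"
    by (simp only:)
  then have "gcdf z + gcdf (- z) = 1"
    by (simp add: tendsto_const_iff)
  then show ?thesis by simp
qed

lemma gcdf_0: "gcdf 0 = 1 / 2"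
  using gcdf_minus[of 0] by simp

section \<open>Effect of a shift on Gaussian masses\<close>

lemma std_normal_density_shift:
  "std_normal_density (s + k) = std_normal_density s * exp (- k * s - k\<^sup>2 / 2)"
  by (simp add: std_normal_density_def power2_sum field_simps flip: exp_add)

text \<open>A shift by \<open>k\<close> multiplies the density at \<open>s\<close> by the factor
  \<open>exp (- k * s - k\<^sup>2 / 2)\<close>, which decreases in \<open>s\<close>. On an interval
  it is therefore largest at the left end and, for the companion lower bound, smallest at the right
  end.\<close>

lemma gcdf_shift_diff_le:
  assumes "0 \<le> k" "u \<le> v"
  shows "gcdf (v + k) - gcdf (u + k) \<le> exp (- k * u - k\<^sup>2 / 2) * (gcdf v - gcdf u)"
proof -
  let ?G = "\<lambda>v. exp (- k * u - k\<^sup>2 / 2) * gcdf v - gcdf (v + k)"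
  have "?G u \<le> ?G v"
  proof (rule DERIV_nonneg_imp_nondecreasing[OF assms(2)])
    fix x assume x: "u \<le> x" "x \<le> v"
    have "(?G has_real_derivative exp (- k * u - k\<^sup>2 / 2) * std_normal_density x - std_normal_density (x + k)) (at x)"
      by (rule derivative_eq_intros gcdf_has_real_derivative DERIV_chain2[OF gcdf_has_real_derivative] | simp)+
    moreover have "exp (- k * x - k\<^sup>2 / 2) \<le> exp (- k * u - k\<^sup>2 / 2)"
      using x assms by (simp add: mult_left_mono)
    then have "0 \<le> exp (- k * u - k\<^sup>2 / 2) * std_normal_density x - std_normal_density (x + k)"
      by (simp add: std_normal_density_shift mult.commute mult_left_mono)
    ultimately show "\<exists>y. (?G has_real_derivative y) (at x) \<and> 0 \<le> y" by blast
  qed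
  then show ?thesis by (simp add: algebra_simps)
qed

lemma gcdf_shift_diff_ge:
  assumes "0 \<le> k" "u \<le> v"
  shows "exp (- k * v - k\<^sup>2 / 2) * (gcdf v - gcdf u) \<le> gcdf (v + k) - gcdf (u + k)"
proof -
  let ?G = "\<lambda>u. exp (- k * v - k\<^sup>2 / 2) * gcdf u - gcdf (u + k)"
  have "?G v \<le> ?G u"
  proof (rule DERIV_nonpos_imp_nonincreasing[OF assms(2)])
    fix x assume x: "u \<le> x" "x \<le> v"
    have "(?G has_real_derivative exp (- k * v - k\<^sup>2 / 2) * std_normal_density x - std_normal_density (x + k)) (at x)"
      by (rule derivative_eq_intros gcdf_has_real_derivative DERIV_chain2[OF gcdf_has_real_derivative] | simp)+
    moreover have "exp (- k * v - k\<^sup>2 / 2) \<le> exp (- k * x - k\<^sup>2 / 2)"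
      using x assms by (simp add: mult_left_mono)
    then have "exp (- k * v - k\<^sup>2 / 2) * std_normal_density x - std_normal_density (x + k) \<le> 0"
      by (simp add: std_normal_density_shift mult.commute mult_left_mono)
    ultimately show "\<exists>y. (?G has_real_derivative y) (at x) \<and> y \<le> 0" by blast
  qed
  then show ?thesis by (simp add: algebra_simps)
qed

text \<open>The limit of \<open>gcdf_shift_diff_ge\<close> as the left end of the interval tends to
  minus infinity.\<close>

lemma gcdf_shift_ge:
  assumes "0 \<le> k"
  shows "exp (- k * v - k\<^sup>2 / 2) * gcdf v \<le> gcdf (v + k)"
proof -
  have 1: "((\<lambda>u. gcdf (v + k) - gcdf (u + k)) \<longlongrightarrow> gcdf (v + k) - 0) at_bot"
  proof (intro tendsto_intros filterlim_compose[OF gcdf_at_bot])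
    have "\<forall>\<^sub>F u in at_bot. u + k \<le> Z" for Z
      using eventually_le_at_bot[of "Z - k"] by eventually_elim simp
    then show "filterlim (\<lambda>u. u + k) at_bot at_bot" by (simp add: filterlim_at_bot)
  qed
  have 2: "((\<lambda>u. exp (- k * v - k\<^sup>2 / 2) * (gcdf v - gcdf u)) \<longlongrightarrow> exp (- k * v - k\<^sup>2 / 2) * (gcdf v - 0)) at_bot"
    by (intro tendsto_intros gcdf_at_bot)
  have 3: "\<forall>\<^sub>F u in at_bot. exp (- k * v - k\<^sup>2 / 2) * (gcdf v - gcdf u) \<le> gcdf (v + k) - gcdf (u + k)"
    using eventually_le_at_bot[of v] by eventually_elim (rule gcdf_shift_diff_ge[OF assms])
  show ?thesis
    using tendsto_le[OF trivial_limit_at_bot_linorder 1 2 3] by simp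
qed

text \<open>\<open>gcdf_shift_ge\<close> at \<open>v = - k\<close> moves the argument to 0, where
  \<Phi> is 1/2, and bounds the tail \<Phi>(-k).\<close>

lemma gcdf_ge_exp:
  assumes "0 \<le> k"
  shows "1 - 1 / 2 * exp (- (k\<^sup>2 / 2)) \<le> gcdf k"
proof -
  have "exp (k\<^sup>2 / 2) * gcdf (- k) \<le> 1 / 2"
    using gcdf_shift_ge[OF assms, of "- k"] by (simp add: gcdf_0 power2_eq_square)
  then have "gcdf (- k) \<le> 1 / 2 * exp (- (k\<^sup>2 / 2))"
    by (simp add: exp_minus field_simps)
  then show ?thesis by (simp add: gcdf_minus)
qed

text \<open>Let \<open>x \<le> y\<close>. The interval from \<open>y\<close> to \<open>z\<close> has
  the same mass as the half-line up to \<open>x\<close> and lies further to the right, at points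
  where the shift factor is smaller; so it gains no more from the shift than the half-line
  does.\<close>

lemma gcdf_shift_subadditive:
  assumes "0 \<le> k" and "gcdf z = gcdf x + gcdf y"
  shows "gcdf (z + k) \<le> gcdf (x + k) + gcdf (y + k)"
proof -
  have "gcdf (z + k) \<le> gcdf (x + k) + gcdf (y + k)" if "x \<le> y" and z: "gcdf z = gcdf x + gcdf y" for x y
  proof -
    have "gcdf y < gcdf z" using z gcdf_pos[of x] by linarith
    then have "gcdf (z + k) - gcdf (y + k) \<le> exp (- k * y - k\<^sup>2 / 2) * (gcdf z - gcdf y)"
      using assms(1) by (intro gcdf_shift_diff_le) auto
    also have "\<dots> = exp (- k * y - k\<^sup>2 / 2) * gcdf x" using z by simp
    also have "\<dots> \<le> exp (- k * x - k\<^sup>2 / 2) * gcdf x"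
      using \<open>x \<le> y\<close> assms(1) by (intro mult_right_mono) (auto simp: mult_left_mono less_imp_le)
    also have "\<dots> \<le> gcdf (x + k)" by (rule gcdf_shift_ge[OF assms(1)])
    finally show ?thesis by simp
  qed
  then show ?thesis
    using assms(2) by (metis add.commute linear)
qed

section \<open>The distribution function on the extended line\<close>

lemma std_normal_cdf_ereal: "std_normal_cdf (ereal z) = gcdf z"
proof -
  have eq: "(LBINT s=-\<infinity>..ereal z. exp (- (s\<^sup>2) / 2))
      = (LINT s|lborel. indicator {..<z} s * exp (- (s\<^sup>2) / 2))"
    by (simp add: interval_lebesgue_integral_def set_lebesgue_integral_def einterval_def lessThan_def)
  have i: "integrable lborel std_normal_density" by simp
  have "std_normal_cdf (ereal z) = (LINT s|lborel. indicator {..<z} s * std_normal_density s)"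
    unfolding std_normal_cdf_def eq by (simp add: std_normal_density_def flip: integral_mult_right_zero)
  also have "\<dots> = measure std_normal_distribution {..<z}"
  proof -
    have "emeasure std_normal_distribution {..<z}
        = (\<integral>\<^sup>+ x. ennreal (indicator {..<z} x * std_normal_density x) \<partial>lborel)"
      by (subst emeasure_density) (auto intro!: nn_integral_cong split: split_indicator)
    also have "\<dots> = ennreal (LINT x|lborel. indicator {..<z} x * std_normal_density x)"
      using integrable_real_mult_indicator[OF _ i, of "{..<z}"]
      by (intro nn_integral_eq_integral) (auto simp: mult.commute)
    finally show ?thesis by (simp add: measure_def integral_nonneg_AE)
  qed
  also have "\<dots> = measure std_normal_distribution {..z}"
  proof -
    interpret real_distribution std_normal_distribution by (rule real_dist_normal_dist)
    have "isCont (cdf std_normal_distribution) z" using isCont_gcdf unfolding gcdf_def .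
    then have "measure std_normal_distribution {z} = 0" by (simp add: isCont_cdf)
    moreover have "{..z} = {..<z} \<union> {z}" by auto
    then have "measure std_normal_distribution {..z}
      = measure std_normal_distribution {..<z} + measure std_normal_distribution {z}"
      by (simp only:) (subst finite_measure_Union, auto)
    ultimately show ?thesis by simp
  qed
  finally show ?thesis by (simp add: gcdf_def cdf_def)
qed

lemma inj_std_normal_cdf: "inj std_normal_cdf"
proof (rule injI)
  fix x y assume "std_normal_cdf x = std_normal_cdf y"
  then show "x = y"
    using gcdf_pos gcdf_less_1 less_irrefl
    by (cases x; cases y)
      (auto simp: std_normal_cdf_ereal std_normal_cdf_infinity std_normal_cdf_minus_infinity,
       (metis gcdf_pos gcdf_less_1 less_irrefl)+)
qed

lemma inv_std_normal_cdf:
  "inv std_normal_cdf 0 = -\<infinity>" "inv std_normal_cdf 1 = \<infinity>" "inv std_normal_cdf (gcdf z) = ereal z"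
  by (metis inj_std_normal_cdf inv_f_f std_normal_cdf_infinity std_normal_cdf_minus_infinity
      std_normal_cdf_ereal)+

section \<open>Half-lines: transport from the Gaussian measure\<close>

text \<open>\<open>modulus\<close> is the integrated form of the convexity inequality: it compares
  the masses of two intervals with the mass of the interval of their midpoints. Points of the two
  intervals are at least \<open>c - b\<close> apart, and the argument of \<delta> is half a
  distance. The points \<alpha> and \<beta> encode bounded support, which makes \<open>T\<close>
  bounded.\<close>

locale log_concave_cdf =
  fixes F :: "real \<Rightarrow> real" and \<alpha> \<beta> :: real and \<delta> :: "real \<Rightarrow> real"
  assumes F_mono: "x \<le> y \<Longrightarrow> F x \<le> F y"
    and F_cont: "continuous_on UNIV F"
    and F_\<alpha>: "F \<alpha> = 0" and F_\<beta>: "F \<beta> = 1"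
    and \<delta>_nonneg: "0 \<le> t \<Longrightarrow> 0 \<le> \<delta> t"
    and \<delta>_mono: "0 \<le> s \<Longrightarrow> s \<le> t \<Longrightarrow> \<delta> s \<le> \<delta> t"
    and modulus: "a \<le> b \<Longrightarrow> b \<le> c \<Longrightarrow> c \<le> d \<Longrightarrow>
      (F b - F a) * (F d - F c) * exp (\<delta> ((c - b) / 2)) \<le> (F ((b + d) / 2) - F ((a + c) / 2))\<^sup>2"
begin

text \<open>Suppose that \<open>F\<close> has a maximal plateau from \<open>a\<close> to
  \<open>b\<close> at a level strictly between 0 and 1. The two adjacent intervals of the same
  length have positive mass, and the interval of their midpoints is exactly the plateau, of mass 0.
  This contradicts \<open>modulus\<close>.\<close>

lemma F_strict_mono:
  assumes "u < v" "0 < F u" "F u < 1"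
  shows "F u < F v"
proof (rule ccontr)
  assume "\<not> F u < F v"
  then have Fuv: "F v = F u" using F_mono[of u v] assms by simp
  define S where "S = {x. F x = F u}"
  have S: "\<alpha> \<le> x \<and> x \<le> \<beta>" if "x \<in> S" for x
    using that F_mono[of x \<alpha>] F_mono[of \<beta> x] F_\<alpha> F_\<beta> assms unfolding S_def by (auto intro: ccontr)
  have "closed S"
    unfolding S_def by (intro closed_Collect_eq F_cont continuous_intros)
  moreover have "bounded S"
    by (rule bounded_subset[OF bounded_closed_interval[of \<alpha> \<beta>]]) (use S in auto)
  ultimately have "compact S" by (simp add: compact_eq_bounded_closed)
  moreover have uS: "u \<in> S" and vS: "v \<in> S" using Fuv by (auto simp: S_def)
  ultimately obtain a b where a: "a \<in> S" "\<forall>x\<in>S. a \<le> x" and b: "b \<in> S" "\<forall>x\<in>S. x \<le> b"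
    by (metis compact_attains_inf compact_attains_sup empty_iff)
  have "a < b" using a b uS vS assms(1) by force
  define e where "e = b - a"
  have e: "0 < e" using \<open>a < b\<close> by (simp add: e_def)
  have "a - e \<notin> S" using a e by force
  moreover have "b + e \<notin> S" using b e by force
  ultimately have "F (a - e) < F a" "F b < F (b + e)"
    using F_mono[of "a - e" a] F_mono[of b "b + e"] e a b unfolding S_def by auto
  then have "0 < (F a - F (a - e)) * (F (b + e) - F b) * exp (\<delta> ((b - a) / 2))" by simp
  also have "\<dots> \<le> (F ((a + (b + e)) / 2) - F ((a - e + b) / 2))\<^sup>2"
    using e \<open>a < b\<close> by (intro modulus) auto
  also have "\<dots> = (F b - F a)\<^sup>2" by (simp add: e_def)
  also have "\<dots> = 0" using a b by (simp add: S_def)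
  finally show False by simp
qed

text \<open>The choice is immaterial: \<open>F_T\<close> gives existence and \<open>T_eqI\<close>
  uniqueness of the preimage.\<close>

definition T :: "real \<Rightarrow> real" where
  "T z = (SOME x. F x = gcdf z)"

lemma F_T [simp]: "F (T z) = gcdf z"
proof -
  have "\<alpha> \<le> \<beta>" using F_mono[of \<beta> \<alpha>] F_\<alpha> F_\<beta> by (auto intro: ccontr)
  then have "\<exists>x. F x = gcdf z"
    using IVT'[of F \<alpha> "gcdf z" \<beta>] F_\<alpha> F_\<beta> less_imp_le[OF gcdf_pos[of z]] less_imp_le[OF gcdf_less_1[of z]]
    by (auto intro: continuous_on_subset[OF F_cont])
  then show ?thesis unfolding T_def by (rule someI_ex)
qed

lemma T_eqI:
  assumes "F x = gcdf z"
  shows "T z = x"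
  using F_strict_mono[of x "T z"] F_strict_mono[of "T z" x] assms
  by (cases rule: linorder_cases[of x "T z"]) auto

lemma T_strict_mono: "z < z' \<Longrightarrow> T z < T z'"
  using F_mono[of "T z'" "T z"] by (auto intro: ccontr)

lemma T_mono: "z \<le> z' \<Longrightarrow> T z \<le> T z'"
  using T_strict_mono[of z z'] by (cases "z = z'") auto

lemma T_bounds: "\<alpha> \<le> T z" "T z \<le> \<beta>"
  using F_mono[of "T z" \<alpha>] F_mono[of \<beta> "T z"] F_\<alpha> F_\<beta> gcdf_pos[of z] gcdf_less_1[of z]
  by (auto intro: ccontr simp: not_le)

lemma isCont_T: "isCont T z"
  unfolding isCont_def
proof (rule tendstoI)
  fix e :: real assume e: "0 < e"
  have 1: "gcdf z < F (T z + e)"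
    using F_strict_mono[of "T z" "T z + e"] e by simp
  \<comment> \<open>\<open>F (T z - e)\<close> may be 0, where \<open>F_strict_mono\<close> is
    silent, so uniqueness of the preimage is used instead.\<close>
  have 2: "F (T z - e) < gcdf z"
  proof (rule ccontr)
    assume "\<not> F (T z - e) < gcdf z"
    then have "F (T z - e) = gcdf z" using F_mono[of "T z - e" "T z"] e by simp
    then show False using T_eqI e by fastforce
  qed
  have "(gcdf \<longlongrightarrow> gcdf z) (at z)" using isCont_gcdf by (simp add: isCont_def)
  from order_tendstoD(1)[OF this 2] order_tendstoD(2)[OF this 1]
  show "\<forall>\<^sub>F x in at z. dist (T x) (T z) < e"
  proof eventually_elim
    case (elim x)
    have "T z - e < T x" using F_mono[of "T x" "T z - e"] elim(1) by (auto intro: ccontr simp: not_less)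
    moreover have "T x < T z + e" using F_mono[of "T z + e" "T x"] elim(2) by (auto intro: ccontr simp: not_less)
    ultimately show ?case by (simp add: dist_real_def)
  qed
qed

lemma ex_T_antiderivative: "\<exists>Q. \<forall>z. (Q has_real_derivative T z) (at z)"
proof (intro exI allI)
  fix z :: real
  let ?a = "min 0 z - 1" and ?b = "max 0 z + 1"
  have "((\<lambda>u. LBINT y=ereal 0..ereal u. T y) has_vector_derivative T z) (at z within {?a..?b})"
    by (rule interval_integral_FTC2) (auto intro: continuous_at_imp_continuous_on isCont_T)
  moreover have "at z within {?a..?b} = at z" by (rule at_within_interior) auto
  ultimately show "((\<lambda>u. LBINT y=ereal 0..ereal u. T y) has_real_derivative T z) (at z)"
    by (simp only: has_real_derivative_iff_has_vector_derivative)
qed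

lemma antiderivative_diff_bounds:
  assumes Q: "\<And>z. (Q has_real_derivative T z) (at z)" and "a \<le> b"
  shows "(b - a) * T a \<le> Q b - Q a" "Q b - Q a \<le> (b - a) * T b"
proof -
  consider "a = b" | "a < b" using assms(2) by linarith
  then have "(b - a) * T a \<le> Q b - Q a \<and> Q b - Q a \<le> (b - a) * T b"
  proof cases
    case 2
    then obtain x where "a < x" "x < b" "Q b - Q a = (b - a) * T x"
      using MVT2[of a b Q T] Q by blast
    then show ?thesis using 2 T_mono[of a x] T_mono[of x b] by simp
  qed simp
  then show "(b - a) * T a \<le> Q b - Q a" "Q b - Q a \<le> (b - a) * T b" by auto
qed

text \<open>
  At the maximum point \<open>m\<close>, \<open>S' m = 0\<close> says that \<open>T m\<close> is the midpoint of \<open>T (m - t)\<close> and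
  \<open>T (m + t)\<close>, and \<open>S' (m + u) \<le> 0\<close>, which holds for arbitrarily small \<open>u > 0\<close>, takes over the role
  of \<open>S'' m \<le> 0\<close>: \<open>T\<close> need not be differentiable.
\<close>

lemma T_increment_modulus:
  assumes t: "0 < t" and \<rho>: "0 \<le> \<rho>" "\<rho> < T (z + t / 2) - T (z - t / 2)"
  shows "\<delta> (\<rho> / 4) \<le> t\<^sup>2"
proof -
  obtain Q where Q: "\<And>z. (Q has_real_derivative T z) (at z)"
    using ex_T_antiderivative by blast
  \<comment> \<open>\<open>S z\<close> is the integral of \<open>T (z + s) - T (z - s)\<close> over
    \<open>s\<close> from 0 to \<open>t\<close>. The integrand increases with \<open>s\<close>: it
    never exceeds its value at \<open>t\<close>, and on the second half of the range it is at least
    its value at \<open>t / 2\<close>.\<close>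
  define S where "S z = Q (z + t) + Q (z - t) - 2 * Q z" for z
  define S' where "S' z = T (z + t) + T (z - t) - 2 * T z" for z
  have S_deriv: "(S has_real_derivative S' z) (at z)" for z
    unfolding S_def S'_def
    by (rule derivative_eq_intros DERIV_chain2[OF Q] Q refl | simp)+
  have S_upper: "S z \<le> t * (T (z + t) - T (z - t))" for z
    using antiderivative_diff_bounds(2)[OF Q, of z "z + t"] antiderivative_diff_bounds(1)[OF Q, of "z - t" z] t
    by (simp add: S_def algebra_simps)
  have S_lower: "t / 2 * (T (z + t / 2) - T (z - t / 2)) \<le> S z" for z
    using antiderivative_diff_bounds(1)[OF Q, of "z + t / 2" "z + t"]
      antiderivative_diff_bounds(1)[OF Q, of z "z + t / 2"]
      antiderivative_diff_bounds(2)[OF Q, of "z - t / 2" z]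
      antiderivative_diff_bounds(2)[OF Q, of "z - t" "z - t / 2"] t
    by (simp add: S_def algebra_simps)
  have S_pos: "0 < S z" for z
    using S_lower[of z] T_strict_mono[of "z - t / 2" "z + t / 2"] t
    by (intro less_le_trans[OF _ S_lower]) simp
  \<comment> \<open>Far out, the bounded function \<open>T\<close> varies by less than
    \<open>e\<close> over a window of width \<open>2 * t\<close>, so \<open>S\<close> is below
    \<open>S 0\<close> there. A maximum over a compact interval that contains 0 is then a global
    one.\<close>
  define e where "e = S 0 / t"
  have e: "0 < e" using S_pos t by (simp add: e_def)
  have bdd: "bdd_above (range T)" "bdd_below (range T)"
    using T_bounds by (auto intro!: bdd_aboveI bdd_belowI)
  obtain z1 where z1: "(SUP z. T z) - e < T z1"
    using less_cSUP_iff[of UNIV T "(SUP z. T z) - e"] bdd e by auto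
  obtain z2 where z2: "T z2 < (INF z. T z) + e"
    using cINF_less_iff[of UNIV T "(INF z. T z) + e"] bdd e by auto
  have out: "S x < S 0" if "x < z2 - t \<or> z1 + t < x" for x
  proof -
    have "T (x + t) - T (x - t) < e"
      using that
    proof
      assume "x < z2 - t"
      then have "T (x + t) \<le> T z2" by (intro T_mono) simp
      moreover have "(INF z. T z) \<le> T (x - t)" using bdd by (auto intro: cINF_lower)
      ultimately show ?thesis using z2 by simp
    next
      assume "z1 + t < x"
      then have "T z1 \<le> T (x - t)" by (intro T_mono) simp
      moreover have "T (x + t) \<le> (SUP z. T z)" using bdd by (auto intro: cSUP_upper)
      ultimately show ?thesis using z1 by simp
    qed
    then have "t * (T (x + t) - T (x - t)) < S 0" using t by (simp add: e_def field_simps)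
    then show ?thesis using S_upper[of x] by linarith
  qed
  define I where "I = {min 0 (z2 - t)..max 0 (z1 + t)}"
  have "0 \<in> I" by (auto simp: I_def)
  moreover have "continuous_on I S"
    by (meson DERIV_isCont S_deriv continuous_at_imp_continuous_on)
  moreover have "compact I" by (simp add: I_def)
  ultimately obtain m where m: "m \<in> I" "\<And>x. x \<in> I \<Longrightarrow> S x \<le> S m"
    using continuous_attains_sup[of I S] by blast
  have max: "S x \<le> S m" for x
  proof (cases "x \<in> I")
    case False
    then have "S x < S 0" by (intro out) (auto simp: I_def)
    then show ?thesis using m(2)[OF \<open>0 \<in> I\<close>] by simp
  qed (rule m)
  have S'm: "S' m = 0"
    by (rule DERIV_local_max[OF S_deriv, of 1]) (auto intro: max)
  define h where "h = T m - T (m - t)"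
  have h: "T (m + t) = T m + h" "T (m - t) = T m - h"
    using S'm by (simp_all add: h_def S'_def)
  \<comment> \<open>The origin of the factor 4: a half-step increment of \<open>T\<close>, times
    \<open>t / 2\<close>, is at most \<open>S z \<le> S m\<close>, and \<open>S m\<close> is at most
    \<open>t\<close> times the full increment \<open>2 * h\<close> at \<open>m\<close>.\<close>
  have "T (z + t / 2) - T (z - t / 2) \<le> 4 * h"
  proof -
    have "t / 2 * (T (z + t / 2) - T (z - t / 2)) \<le> t / 2 * (4 * h)"
      using S_lower[of z] max[of z] S_upper[of m] by (simp add: h mult_ac)
    then show ?thesis by (rule mult_left_le_imp_le) (use t in simp)
  qed
  then have \<rho>h: "\<rho> / 4 < h" using \<rho> by simp
  have "isCont T (m - t)" by (rule isCont_T)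
  then have "((\<lambda>v. T (m - t + v)) \<longlongrightarrow> T (m - t)) (at 0)"
    unfolding isCont_iff .
  \<comment> \<open>The slack \<open>2 * (h - \<rho> / 4)\<close> is chosen so that after the left
    window is opened, the gap up to \<open>T (m + t)\<close> is still at least
    \<open>\<rho> / 2\<close>.\<close>
  then have ev: "\<forall>\<^sub>F v in at_right 0. T (m - t + v) < T (m - t) + 2 * (h - \<rho> / 4)"
    using \<rho>h by (intro order_tendstoD(2)) (auto intro: tendsto_mono[OF at_le])
  have bound: "\<delta> (\<rho> / 4) \<le> t\<^sup>2 + t * v" if v0: "0 < v0" and
     v0T: "\<And>v. 0 < v \<Longrightarrow> v < v0 \<Longrightarrow> T (m - t + v) < T (m - t) + 2 * (h - \<rho> / 4)" and "v0 \<le> t" "v0 \<le> v" for v0 v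
  proof -
    \<comment> \<open>\<open>S (m + v0) \<le> S m\<close> forces a nonpositive derivative somewhere
      in between; this is the window length \<open>u\<close>.\<close>
    obtain w where w: "m < w" "w < m + v0" "S (m + v0) - S m = (m + v0 - m) * S' w"
      using MVT2[of m "m + v0" S S'] S_deriv v0 by auto
    define u where "u = w - m"
    have u: "0 < u" "u < v0" "w = m + u" using w by (auto simp: u_def)
    have "S' w \<le> 0"
      using w(3) max[of "m + v0"] v0 by (metis add_diff_cancel_left' diff_le_0_iff_le mult_le_0_iff not_le)
    then have mid: "(T (m + t + u) + T (m - t + u)) / 2 \<le> T (m + u)"
      by (simp add: S'_def u(3) algebra_simps)
    \<comment> \<open>\<open>D\<close>, \<open>A\<close> and \<open>B\<close> are the Gaussian
      masses of windows of length \<open>u\<close> that start at \<open>m\<close>,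
      \<open>m - t\<close> and \<open>m + t\<close>, hence also the masses that \<open>F\<close>
      gives to their images under \<open>T\<close>. The product of the densities at
      \<open>m - t\<close> and \<open>m + t\<close> is \<open>exp (- t\<^sup>2)\<close> times the
      square of the density at \<open>m\<close>; the extra factor \<open>exp (- t * u)\<close> below
      is the price of a window of positive length.\<close>
    define D where "D = gcdf (m + u) - gcdf m"
    have D: "0 < D" using u by (simp add: D_def)
    define A B where "A = gcdf (m - t + u) - gcdf (m - t)" and "B = gcdf (m + t + u) - gcdf (m + t)"
    have A: "exp (t * m - t\<^sup>2 / 2) * D \<le> A"
    proof -
      have "D \<le> exp (- t * (m - t) - t\<^sup>2 / 2) * A"
        using gcdf_shift_diff_le[of t "m - t" "m - t + u"] t u by (simp add: D_def A_def)
      also have "- t * (m - t) - t\<^sup>2 / 2 = - (t * m - t\<^sup>2 / 2)"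
        by (simp add: power2_eq_square algebra_simps)
      finally show ?thesis by (simp add: exp_minus field_simps)
    qed
    have B: "exp (- t * (m + u) - t\<^sup>2 / 2) * D \<le> B"
      using gcdf_shift_diff_ge[of t m "m + u"] t u by (simp add: D_def B_def algebra_simps)
    have "exp (- t * u - t\<^sup>2) * D\<^sup>2 = (exp (t * m - t\<^sup>2 / 2) * D) * (exp (- t * (m + u) - t\<^sup>2 / 2) * D)"
      by (simp add: power2_eq_square algebra_simps flip: exp_add)
    also have "\<dots> \<le> A * B"
      using A B D by (intro mult_mono) (auto simp: A_def u less_imp_le)
    finally have AB: "exp (- t * u - t\<^sup>2) * D\<^sup>2 \<le> A * B" .
    have "T (m - t + u) \<le> T (m - t) + 2 * (h - \<rho> / 4)" using v0T[of u] u by simp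
    then have gap: "\<rho> / 4 \<le> (T (m + t) - T (m - t + u)) / 2" by (simp add: h)
    have "exp (\<delta> (\<rho> / 4)) * (exp (- t * u - t\<^sup>2) * D\<^sup>2) \<le> exp (\<delta> ((T (m + t) - T (m - t + u)) / 2)) * (A * B)"
      using gap \<rho> D by (intro mult_mono[OF _ AB]) (auto intro!: \<delta>_mono)
    also have "\<dots> \<le> (F ((T (m - t + u) + T (m + t + u)) / 2) - F ((T (m - t) + T (m + t)) / 2))\<^sup>2"
      using modulus[of "T (m - t)" "T (m - t + u)" "T (m + t)" "T (m + t + u)"] u t gap \<rho>
      by (simp add: A_def B_def T_mono mult_ac)
    \<comment> \<open>The interval of midpoints starts at \<open>T m\<close>, because
      \<open>S' m = 0\<close>, and ends no later than \<open>T (m + u)\<close>, by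
      \<open>mid\<close>.\<close>
    also have "\<dots> \<le> D\<^sup>2"
    proof (rule power_mono)
      have "F ((T (m - t + u) + T (m + t + u)) / 2) \<le> gcdf (m + u)"
        using F_mono[OF mid] by (simp add: add.commute)
      moreover have "(T (m - t) + T (m + t)) / 2 = T m" by (simp add: h)
      ultimately show "F ((T (m - t + u) + T (m + t + u)) / 2) - F ((T (m - t) + T (m + t)) / 2) \<le> D"
        by (simp add: D_def)
      show "0 \<le> F ((T (m - t + u) + T (m + t + u)) / 2) - F ((T (m - t) + T (m + t)) / 2)"
        using u by (simp add: F_mono T_mono add_mono)
    qed
    finally have "exp (\<delta> (\<rho> / 4) + (- t * u - t\<^sup>2)) * D\<^sup>2 \<le> 1 * D\<^sup>2"
      by (simp add: exp_add mult_ac)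
    then have "exp (\<delta> (\<rho> / 4) + (- t * u - t\<^sup>2)) \<le> 1"
      by (rule mult_right_le_imp_le) (use D in simp)
    then have "\<delta> (\<rho> / 4) \<le> t\<^sup>2 + t * u" by simp
    also have "t * u \<le> t * v" using u t that by simp
    finally show ?thesis by simp
  qed
  obtain v1 where v1: "0 < v1" "\<And>v. 0 < v \<Longrightarrow> v < v1 \<Longrightarrow> T (m - t + v) < T (m - t) + 2 * (h - \<rho> / 4)"
    using ev by (auto simp: eventually_at_right_field)
  show ?thesis
  proof (rule field_le_epsilon)
    fix \<epsilon> :: real assume "0 < \<epsilon>"
    then show "\<delta> (\<rho> / 4) \<le> t\<^sup>2 + \<epsilon>"
      using bound[of "min v1 (min t (\<epsilon> / t))" "\<epsilon> / t"] v1 t by simp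
  qed
qed

text \<open>\<open>T_increment_modulus\<close> with centre \<open>(x + y) / 2\<close> and step
  \<open>y - x\<close>: a gap on the line forces a gap between the Gaussian quantiles.\<close>

lemma half_line_separation:
  assumes "F u = gcdf x" "F v = gcdf y" "0 \<le> \<rho>" "\<rho> < v - u"
  shows "\<delta> (\<rho> / 4) \<le> (y - x)\<^sup>2" "x < y"
proof -
  have uv: "T x = u" "T y = v" using assms T_eqI by auto
  have "u < v" using assms by simp
  then show "x < y" using T_mono[of y x] uv by (auto intro: ccontr)
  then show "\<delta> (\<rho> / 4) \<le> (y - x)\<^sup>2"
    using T_increment_modulus[of "y - x" \<rho> "(x + y) / 2"] assms uv
    by (simp add: field_simps) 
qed

end

section \<open>Compact subsets of the line\<close>

text \<open>
  This is \<open>p \<mapsto> \<Phi> (\<Phi>\<inverse> p + k)\<close> on the unit interval, with \<open>p\<close> clamped to that interval.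
\<close>

definition gauss_enlarge :: "real \<Rightarrow> real \<Rightarrow> real" where
  "gauss_enlarge k p = (if p \<le> 0 then 0 else if 1 \<le> p then 1 else gcdf ((SOME z. gcdf z = p) + k))"

lemma gauss_enlarge_gcdf [simp]: "gauss_enlarge k (gcdf z) = gcdf (z + k)"
  using gcdf_pos[of z] gcdf_less_1[of z]
  by (auto simp: gauss_enlarge_def not_le[symmetric] simp del: gcdf_pos gcdf_less_1)

lemma gauss_enlarge_0 [simp]: "gauss_enlarge k 0 = 0"
  and gauss_enlarge_1 [simp]: "gauss_enlarge k 1 = 1"
  by (simp_all add: gauss_enlarge_def)

lemma unit_interval_gcdf_cases:
  assumes "0 \<le> p" "p \<le> 1"
  obtains "p = 0" | "p = 1" | z where "p = gcdf z"
  using assms gcdf_surj[of p] by (metis order_le_less)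

lemma gauss_enlarge_bounds: "0 \<le> gauss_enlarge k p" "gauss_enlarge k p \<le> 1"
  by (auto simp: gauss_enlarge_def less_imp_le)

lemma gauss_enlarge_mono:
  assumes "0 \<le> p" "p \<le> q" "q \<le> 1"
  shows "gauss_enlarge k p \<le> gauss_enlarge k q"
proof -
  have p: "p \<le> 1" and q: "0 \<le> q" using assms by auto
  show ?thesis
  proof (cases rule: unit_interval_gcdf_cases[OF assms(1) p])
    case 2
    then show ?thesis using assms by simp
  next
    case (3 x)
    show ?thesis
      by (cases rule: unit_interval_gcdf_cases[OF q assms(3)])
        (use 3 assms gauss_enlarge_bounds gcdf_pos[of x] less_imp_le[OF gcdf_less_1[of "x + k"]] in \<open>auto simp: not_le[symmetric] simp del: gcdf_pos\<close>)
  qed (simp add: gauss_enlarge_bounds)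
qed

lemma gauss_enlarge_subadditive:
  assumes "0 \<le> k" "0 \<le> p" "0 \<le> q" "p + q \<le> 1"
  shows "gauss_enlarge k (p + q) \<le> gauss_enlarge k p + gauss_enlarge k q"
proof -
  have "p \<le> 1" "q \<le> 1" "0 \<le> p + q" using assms by auto
  show ?thesis
  proof (cases rule: unit_interval_gcdf_cases[OF assms(2) \<open>p \<le> 1\<close>])
    case 2
    then show ?thesis using assms by simp
  next
    case (3 x)
    note x = this
    show ?thesis
    proof (cases rule: unit_interval_gcdf_cases[OF assms(3) \<open>q \<le> 1\<close>])
      case 2
      then show ?thesis using assms x gcdf_pos[of x] by (simp add: not_le[symmetric] del: gcdf_pos)
    next
      case (3 y)
      show ?thesis
      proof (cases rule: unit_interval_gcdf_cases[OF \<open>0 \<le> p + q\<close> assms(4)])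
        case 1
        then show ?thesis using gauss_enlarge_bounds(1) by simp
      next
        \<comment> \<open>Here the quantiles are opposite and the left side is 1, so the claim
          becomes \<Phi>(x - k) \<le> \<Phi>(x + k).\<close>
        case 2
        then have "gcdf y = gcdf (- x)" using x 3 by (simp add: gcdf_minus)
        then have y: "y = - x" by simp
        have "gcdf (y + k) = 1 - gcdf (x - k)" using gcdf_minus[of "x - k"] y by simp
        moreover have "gcdf (x - k) \<le> gcdf (x + k)" using assms by simp
        ultimately show ?thesis using 2 x 3 by simp
      next
        case z: (3 z)
        then have "gcdf z = gcdf x + gcdf y" using x 3 by simp
        from gcdf_shift_subadditive[OF assms(1) this] show ?thesis
          unfolding z unfolding x 3 by simp
      qed
    qed simp
  qed simp
qed

text \<open>Since \<Phi>(-z) = 1 - \<Phi>(z), the map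
  \<open>p \<mapsto> 1 - gauss_enlarge k p\<close> is its own inverse on the unit interval. This is
  what allows enlargement estimates to be passed to complements.\<close>

lemma gauss_enlarge_involution:
  assumes "0 \<le> p" "p \<le> 1"
  shows "gauss_enlarge k (1 - gauss_enlarge k p) = 1 - p"
proof (cases rule: unit_interval_gcdf_cases[OF assms])
  case (3 z)
  then have "gauss_enlarge k (1 - gauss_enlarge k p) = gauss_enlarge k (gcdf (- (z + k)))"
    by (simp only: gcdf_minus gauss_enlarge_gcdf)
  also have "\<dots> = gcdf (- z)" by (subst gauss_enlarge_gcdf) simp
  finally show ?thesis using 3 by (simp add: gcdf_minus)
qed auto

lemma (in real_distribution) measure_Icc_no_atoms:
  assumes "\<And>x. measure M {x} = 0" "a \<le> b"
  shows "measure M {a..b} = cdf M b - cdf M a"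
proof -
  have "measure M {a..b} = measure M ({a} \<union> {a<..b})"
    using assms by (intro arg_cong[where f="measure M"]) auto
  also have "\<dots> = measure M {a} + measure M {a<..b}"
    by (rule finite_measure_Union) auto
  also have "\<dots> = cdf M b - cdf M a"
    using assms cdf_diff_eq[of a b] by (cases "a = b") auto
  finally show ?thesis .
qed

text \<open>Log-concavity is left behind here: the passage from half-lines to compact sets works for
  every atomless distribution for which half-lines gain the Gaussian shift \<open>k\<close> when
  moved by \<rho>.\<close>

locale half_line_enlargement = real_distribution M for M +
  fixes k \<rho> :: real
  assumes k_nonneg: "0 \<le> k" and \<rho>_pos: "0 < \<rho>"
    and no_atoms: "measure M {x} = 0"
    and half_line: "gauss_enlarge k (cdf M u) \<le> cdf M (u + \<rho>)"
begin

lemma cdf_bounds: "0 \<le> cdf M x" "cdf M x \<le> 1"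
  by (auto simp: cdf_def)

lemma measure_Icc: "a \<le> b \<Longrightarrow> measure M {a..b} = cdf M b - cdf M a"
  by (rule measure_Icc_no_atoms[OF no_atoms])

lemma measure_Ioo: 
  assumes "a < b" shows "measure M {a<..<b} = cdf M b - cdf M a"
proof -
  have "cdf M b - cdf M a = measure M ({a<..<b} \<union> {b})"
    using assms cdf_diff_eq[OF assms] by (simp only: ivl_disj_un_singleton)
  also have "\<dots> = measure M {a<..<b} + measure M {b}"
    by (rule finite_measure_Union) auto
  finally show ?thesis using no_atoms by simp
qed

text \<open>The left half-line up to \<open>v - \<rho>\<close>, enlarged, stays to the left of
  \<open>v\<close>; taking complements and using the involution gives the inequality for right
  half-lines.\<close>

lemma half_line_right: "gauss_enlarge k (1 - cdf M v) \<le> 1 - cdf M (v - \<rho>)"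
proof -
  have "gauss_enlarge k (1 - cdf M v) \<le> gauss_enlarge k (1 - gauss_enlarge k (cdf M (v - \<rho>)))"
    using half_line[of "v - \<rho>"] cdf_bounds gauss_enlarge_bounds
    by (intro gauss_enlarge_mono) auto
  also have "\<dots> = 1 - cdf M (v - \<rho>)"
    by (rule gauss_enlarge_involution) (rule cdf_bounds)+
  finally show ?thesis .
qed

text \<open>The complement of the open interval consists of two tails. Each gains from its half-line
  inequality, and by subadditivity the tails together gain at least \<open>gauss_enlarge k\<close>
  of their total mass. \<open>A\<close> lies between the enlarged tails, and the involution turns
  this back into a statement about \<open>A\<close>.\<close>

lemma interval_enlargement:
  assumes A: "A \<in> sets borel" "A \<subseteq> {c + \<rho>..d - \<rho>}" and "A \<noteq> {}"
  shows "gauss_enlarge k (measure M A) \<le> measure M {c<..<d}"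
proof -
  have le: "c + \<rho> \<le> d - \<rho>" using A \<open>A \<noteq> {}\<close> by force
  then have cd: "c < d" using \<rho>_pos by simp
  let ?l = "cdf M c" and ?s = "1 - cdf M d"
  have ls: "?l + ?s \<le> 1" using cdf_nondecreasing[of c d] cd by simp
  have "gauss_enlarge k (?l + ?s) \<le> gauss_enlarge k ?l + gauss_enlarge k ?s"
    using cdf_bounds ls by (intro gauss_enlarge_subadditive k_nonneg) auto
  also have "\<dots> \<le> cdf M (c + \<rho>) + (1 - cdf M (d - \<rho>))"
    by (intro add_mono half_line half_line_right)
  finally have "measure M {c + \<rho>..d - \<rho>} \<le> 1 - gauss_enlarge k (?l + ?s)"
    using le by (simp add: measure_Icc)
  moreover have "measure M A \<le> measure M {c + \<rho>..d - \<rho>}"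
    using A by (intro finite_measure_mono) auto
  ultimately have "gauss_enlarge k (measure M A) \<le> gauss_enlarge k (1 - gauss_enlarge k (?l + ?s))"
    using gauss_enlarge_bounds[of k "?l + ?s"] by (intro gauss_enlarge_mono) auto
  also have "\<dots> = 1 - (?l + ?s)"
    using cdf_bounds[of c] cdf_bounds[of d] ls by (intro gauss_enlarge_involution) auto
  also have "\<dots> = measure M {c<..<d}" using cd by (simp add: measure_Ioo)
  finally show ?thesis .
qed

text \<open>Let \<open>a0\<close> be the least point of \<open>A\<close> and \<open>b0\<close> the
  first point of \<open>B\<close> after it. The part of \<open>A\<close> before \<open>b0\<close>
  fits into an interval free of \<open>B\<close>; the rest starts at \<open>b0 + \<rho>\<close> and
  has a smaller length bound, so the induction applies with \<open>b0\<close> in place of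
  \<open>s\<close>. The regions used are disjoint, and subadditivity combines the two estimates. The
  bound by \<open>n\<close> only makes the recursion finite.\<close>

lemma compact_enlargement_aux:
  assumes B: "closed B" and "compact A" and sep: "\<And>a b. a \<in> A \<Longrightarrow> b \<in> B \<Longrightarrow> \<rho> \<le> \<bar>a - b\<bar>"
    and "A \<subseteq> {s + \<rho>..s + \<rho> + real n * \<rho>}"
  shows "gauss_enlarge k (measure M A) \<le> measure M ({s<..} - B)"
  using assms(2-)
proof (induction n arbitrary: s A)
  case 0
  then have "A \<subseteq> {s + \<rho>}" by simp
  then have "measure M A \<le> measure M {s + \<rho>}" by (intro finite_measure_mono) auto
  then have "measure M A = 0" by (simp add: no_atoms measure_le_0_iff)
  then show ?case by simp
next
  case (Suc n)
  have [measurable]: "A \<in> sets borel" "B \<in> sets borel"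
    using Suc.prems B by (auto intro: borel_compact)
  show ?case
  proof (cases "A = {}")
    case False
    obtain a0 where a0: "a0 \<in> A" "\<And>a. a \<in> A \<Longrightarrow> a0 \<le> a"
      using compact_attains_inf[OF Suc.prems(1) False] by blast
    obtain a1 where a1: "a1 \<in> A" "\<And>a. a \<in> A \<Longrightarrow> a \<le> a1"
      using compact_attains_sup[OF Suc.prems(1) False] by blast
    have sa0: "s + \<rho> \<le> a0" using a0 Suc.prems(3) by auto
    have left: "b \<le> a0 - \<rho>" if "b \<in> B" "b < a0" for b
      using Suc.prems(2)[OF a0(1) that(1)] that by simp
    show ?thesis
    proof (cases "B \<inter> {a0..} = {}")
      case True
      have "gauss_enlarge k (measure M A) \<le> measure M {a0 - \<rho><..<a1 + \<rho>}"
        by (rule interval_enlargement) (use a0 a1 False in auto)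
      also have "\<dots> \<le> measure M ({s<..} - B)"
      proof (rule finite_measure_mono)
        show "{a0 - \<rho><..<a1 + \<rho>} \<subseteq> {s<..} - B"
        proof
          fix x assume x: "x \<in> {a0 - \<rho><..<a1 + \<rho>}"
          then have "x \<notin> B" using left[of x] True by force
          then show "x \<in> {s<..} - B" using x sa0 by simp
        qed
      qed simp
      finally show ?thesis .
    next
      case False
      let ?B = "B \<inter> {a0..}"
      define b0 where "b0 = Inf ?B"
      have bdd: "bdd_below ?B" by auto
      have "b0 \<in> ?B" unfolding b0_def
        using False B bdd by (intro closed_contains_Inf) auto
      then have b0: "b0 \<in> B" "a0 \<le> b0" by auto
      have b0_le: "b0 \<le> b" if "b \<in> B" "a0 \<le> b" for b
        unfolding b0_def using that bdd by (intro cInf_lower) auto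
      have ab: "a0 + \<rho> \<le> b0" using Suc.prems(2)[OF a0(1) b0(1)] b0 by simp
      have split: "a \<le> b0 - \<rho> \<or> b0 + \<rho> \<le> a" if "a \<in> A" for a
        using Suc.prems(2)[OF that b0(1)] by (auto simp: abs_if split: if_splits)
      let ?A1 = "A \<inter> {..b0}" and ?A2 = "A \<inter> {b0..}"
      have A1: "gauss_enlarge k (measure M ?A1) \<le> measure M {a0 - \<rho><..<b0}"
      proof (rule interval_enlargement)
        show "?A1 \<subseteq> {a0 - \<rho> + \<rho>..b0 - \<rho>}"
        proof
          fix a assume "a \<in> ?A1"
          then show "a \<in> {a0 - \<rho> + \<rho>..b0 - \<rho>}" using a0(2)[of a] split[of a] \<rho>_pos by auto
        qed
        show "?A1 \<noteq> {}" using a0 b0 by auto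
      qed simp
      have A2: "gauss_enlarge k (measure M ?A2) \<le> measure M ({b0<..} - B)"
      proof (rule Suc.IH)
        show "compact ?A2" using Suc.prems(1) by (intro compact_Int_closed) auto
        show "\<rho> \<le> \<bar>a - b\<bar>" if "a \<in> ?A2" "b \<in> B" for a b
          using that Suc.prems(2) by auto
        show "?A2 \<subseteq> {b0 + \<rho>..b0 + \<rho> + real n * \<rho>}"
        proof
          fix a assume a: "a \<in> ?A2"
          then have "b0 + \<rho> \<le> a" using split[of a] \<rho>_pos by auto
          moreover have "a \<le> s + \<rho> + real (Suc n) * \<rho>" using a Suc.prems(3) by auto
          ultimately show "a \<in> {b0 + \<rho>..b0 + \<rho> + real n * \<rho>}"
            using sa0 ab \<rho>_pos by (simp add: algebra_simps)
        qed
      qed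
      have un: "measure M A = measure M ?A1 + measure M ?A2"
      proof -
        have "b0 \<notin> A" using split[of b0] \<rho>_pos by auto
        then have "?A1 \<inter> ?A2 = {}" by force
        moreover have "A = ?A1 \<union> ?A2" by auto
        ultimately show ?thesis using finite_measure_Union[of ?A1 ?A2] by simp
      qed
      have "gauss_enlarge k (measure M A) \<le> gauss_enlarge k (measure M ?A1) + gauss_enlarge k (measure M ?A2)"
        unfolding un using un prob_le_1[of A] by (intro gauss_enlarge_subadditive k_nonneg) auto
      also have "\<dots> \<le> measure M {a0 - \<rho><..<b0} + measure M ({b0<..} - B)"
        by (intro add_mono A1 A2)
      also have "\<dots> = measure M ({a0 - \<rho><..<b0} \<union> ({b0<..} - B))"
        by (rule finite_measure_Union[symmetric]) auto
      also have "\<dots> \<le> measure M ({s<..} - B)"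
      proof (rule finite_measure_mono)
        have "x \<notin> B" if "a0 - \<rho> < x" "x < b0" for x
          using left[of x] b0_le[of x] that by force
        then show "{a0 - \<rho><..<b0} \<union> ({b0<..} - B) \<subseteq> {s<..} - B"
          using sa0 ab \<rho>_pos by auto
      qed simp
      finally show ?thesis .
    qed
  qed simp
qed

lemma compact_enlargement:
  assumes A: "compact A" and B: "closed B" and sep: "\<And>a b. a \<in> A \<Longrightarrow> b \<in> B \<Longrightarrow> \<rho> \<le> \<bar>a - b\<bar>"
  shows "gauss_enlarge k (measure M A) \<le> 1 - measure M B"
proof -
  have [measurable]: "B \<in> sets borel" using B by simp
  obtain C where C: "\<And>a. a \<in> A \<Longrightarrow> \<bar>a\<bar> \<le> C"
    using compact_imp_bounded[OF A] by (auto simp: bounded_real)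
  obtain n :: nat where n: "2 * C < real n * \<rho>"
    using reals_Archimedean3[OF \<rho>_pos] by blast
  have "gauss_enlarge k (measure M A) \<le> measure M ({- C - \<rho><..} - B)"
  proof (rule compact_enlargement_aux[OF B A sep])
    show "A \<subseteq> {- C - \<rho> + \<rho>..- C - \<rho> + \<rho> + real n * \<rho>}"
    proof
      fix a assume "a \<in> A"
      from C[OF this] show "a \<in> {- C - \<rho> + \<rho>..- C - \<rho> + \<rho> + real n * \<rho>}"
        using n by (simp add: abs_le_iff)
    qed
  qed
  also have "\<dots> \<le> measure M (space M - B)"
    by (rule finite_measure_mono) auto
  also have "\<dots> = 1 - measure M B"
    by (rule prob_compl) simp
  finally show ?thesis .
qed

end

section \<open>Localisation\<close>

text \<open>For orthonormal \<open>i\<close> and \<open>j\<close>: in the projection to their plane,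
  \<open>K\<close> lies on one side of a line through \<open>c\<close>, with unit normal
  \<open>(a, b)\<close>. The property passes to subsets, so that later cuts do not spoil earlier
  ones.\<close>

definition planar_cut :: "'a::real_inner set \<Rightarrow> 'a \<Rightarrow> 'a \<Rightarrow> 'a \<Rightarrow> bool" where
  "planar_cut K i j c \<longleftrightarrow> (\<exists>a b. a\<^sup>2 + b\<^sup>2 = 1 \<and>
     (\<forall>x\<in>K. (a *\<^sub>R i + b *\<^sub>R j) \<bullet> c \<le> (a *\<^sub>R i + b *\<^sub>R j) \<bullet> x))"

lemma planar_cut_subset: "planar_cut K i j c \<Longrightarrow> K' \<subseteq> K \<Longrightarrow> planar_cut K' i j c"
  unfolding planar_cut_def by blast

locale needle_measure = finite_measure N for N :: "'a::euclidean_space measure" +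
  assumes sets_N [measurable_cong]: "sets N = sets borel"
    and hyperplane_null: "u \<noteq> 0 \<Longrightarrow> measure N {x. u \<bullet> x = c} = 0"
begin

lemma space_N [simp]: "space N = UNIV"
  using sets_eq_imp_space_eq[OF sets_N] by simp

lemma measure_half_space_le:
  assumes [measurable]: "S \<in> sets borel" and "u \<noteq> 0"
  shows "measure N (S \<inter> {x. u \<bullet> x \<le> c}) = measure N S - measure N (S \<inter> {x. c \<le> u \<bullet> x})"
proof -
  have "measure N (S \<inter> {x. u \<bullet> x = c}) \<le> measure N {x. u \<bullet> x = c}"
    by (rule finite_measure_mono) auto
  then have 0: "measure N (S \<inter> {x. u \<bullet> x = c}) = 0"
    using hyperplane_null[OF assms(2)] by (simp add: measure_le_0_iff)
  have "measure N (S \<inter> {x. u \<bullet> x \<le> c}) = measure N ((S \<inter> {x. u \<bullet> x < c}) \<union> (S \<inter> {x. u \<bullet> x = c}))"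
    by (intro arg_cong[where f="measure N"]) auto
  also have "\<dots> = measure N (S \<inter> {x. u \<bullet> x < c})"
    by (subst finite_measure_Union) (auto simp: 0)
  also have "\<dots> = measure N (S - (S \<inter> {x. c \<le> u \<bullet> x}))"
    by (intro arg_cong[where f="measure N"]) auto
  also have "\<dots> = measure N S - measure N (S \<inter> {x. c \<le> u \<bullet> x})"
    by (rule finite_measure_Diff) auto
  finally show ?thesis .
qed

text \<open>Away from the limiting hyperplane, which is a null set, the indicators of the
  half-spaces are eventually constant; dominated convergence applies.\<close>

lemma isCont_measure_half_space:
  fixes u :: "real \<Rightarrow> 'a"
  assumes [measurable]: "S \<in> sets borel" and u: "isCont u t0" "u t0 \<noteq> 0"
  shows "isCont (\<lambda>t. measure N (S \<inter> {x. u t \<bullet> c \<le> u t \<bullet> x})) t0"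
  unfolding continuous_at_sequentially comp_def
proof (intro allI impI)
  fix X :: "nat \<Rightarrow> real" assume "X \<longlonglongrightarrow> t0"
  then have uX: "(\<lambda>n. u (X n)) \<longlonglongrightarrow> u t0"
    using isCont_tendsto_compose[OF u(1)] by blast
  have m: "measure N (S \<inter> {x. v \<bullet> c \<le> v \<bullet> x}) = (\<integral>x. indicator (S \<inter> {x. v \<bullet> c \<le> v \<bullet> x}) x \<partial>N)" for v
    by simp
  show "(\<lambda>n. measure N (S \<inter> {x. u (X n) \<bullet> c \<le> u (X n) \<bullet> x})) \<longlonglongrightarrow> measure N (S \<inter> {x. u t0 \<bullet> c \<le> u t0 \<bullet> x})"
    unfolding m
  proof (rule integral_dominated_convergence[where w="\<lambda>_. 1"])
    have "AE x in N. x \<notin> {x. u t0 \<bullet> x = u t0 \<bullet> c}"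
      using hyperplane_null[OF u(2)] by (intro AE_not_in) (auto simp: emeasure_eq_measure)
    then show "AE x in N. (\<lambda>n. indicator (S \<inter> {x. u (X n) \<bullet> c \<le> u (X n) \<bullet> x}) x :: real)
        \<longlonglongrightarrow> indicator (S \<inter> {x. u t0 \<bullet> c \<le> u t0 \<bullet> x}) x"
    proof eventually_elim
      case (elim x)
      have lim: "(\<lambda>n. u (X n) \<bullet> x - u (X n) \<bullet> c) \<longlonglongrightarrow> u t0 \<bullet> x - u t0 \<bullet> c"
        by (intro tendsto_intros uX)
      show ?case
      proof (cases "u t0 \<bullet> c < u t0 \<bullet> x")
        case True
        then have "\<forall>\<^sub>F n in sequentially. 0 < u (X n) \<bullet> x - u (X n) \<bullet> c"
          by (intro order_tendstoD(1)[OF lim]) simp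
        then have "\<forall>\<^sub>F n in sequentially. (indicator (S \<inter> {x. u (X n) \<bullet> c \<le> u (X n) \<bullet> x}) x :: real)
            = indicator (S \<inter> {x. u t0 \<bullet> c \<le> u t0 \<bullet> x}) x"
          by eventually_elim (use True in \<open>auto split: split_indicator\<close>)
        then show ?thesis by (rule tendsto_eventually)
      next
        case False
        then have less: "u t0 \<bullet> x < u t0 \<bullet> c" using elim by auto
        then have "\<forall>\<^sub>F n in sequentially. u (X n) \<bullet> x - u (X n) \<bullet> c < 0"
          by (intro order_tendstoD(2)[OF lim]) simp
        then have "\<forall>\<^sub>F n in sequentially. (indicator (S \<inter> {x. u (X n) \<bullet> c \<le> u (X n) \<bullet> x}) x :: real)
            = indicator (S \<inter> {x. u t0 \<bullet> c \<le> u t0 \<bullet> x}) x"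
          by eventually_elim (use less in \<open>auto split: split_indicator\<close>)
        then show ?thesis by (rule tendsto_eventually)
      qed
    qed
  qed (auto split: split_indicator)
qed

text \<open>The condition on \<open>A\<close> is an equation, which a cut can preserve in both
  halves by tuning one angle. The condition on \<open>B\<close> is only an inequality, since a
  second equation would need a second parameter; it survives in at least one half.\<close>

definition balanced :: "'a set \<Rightarrow> 'a set \<Rightarrow> real \<Rightarrow> real \<Rightarrow> 'a set \<Rightarrow> bool" where
  "balanced A B p q K \<longleftrightarrow> compact K \<and> convex K \<and> 0 < measure N K \<and>
     measure N (A \<inter> K) = p * measure N K \<and> q * measure N K \<le> measure N (B \<inter> K)"

text \<open>Rotate a hyperplane through \<open>c\<close> by the angle \<open>t\<close> in the plane
  of \<open>i\<close> and \<open>j\<close>. The defect \<open>g\<close> of the equation for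
  \<open>A\<close> changes sign after half a turn, so it vanishes for some angle, and then for both
  halves.\<close>

lemma balanced_bisect:
  assumes K: "balanced A B p q K" and [measurable]: "A \<in> sets borel" "B \<in> sets borel"
    and ij: "norm i = 1" "norm j = 1" "i \<bullet> j = 0"
  obtains K' where "K' \<subseteq> K" "balanced A B p q K'" "planar_cut K' i j c"
proof -
  have Km[measurable]: "K \<in> sets borel" using K by (auto simp: balanced_def intro: borel_compact)
  define u where "u t = cos t *\<^sub>R i + sin t *\<^sub>R j" for t
  have ui: "u t \<bullet> i = cos t" "u t \<bullet> j = sin t" for t
    using ij by (simp_all add: u_def inner_add_left inner_add_right norm_eq_1 inner_commute)
  have u0: "u t \<noteq> 0" for t
  proof
    assume "u t = 0"
    then have "cos t = 0" "sin t = 0" using ui[of t] by auto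
    then show False using sin_cos_squared_add[of t] by simp
  qed
  define H where "H t = {x. u t \<bullet> c \<le> u t \<bullet> x}" for t
  have Hm[measurable]: "H t \<in> sets borel" for t unfolding H_def by measurable
  define g where "g t = measure N (A \<inter> K \<inter> H t) - p * measure N (K \<inter> H t)" for t
  have cont: "isCont g t" for t
    unfolding g_def H_def
    by (intro continuous_intros isCont_measure_half_space u0) (auto simp: u_def intro!: continuous_intros)
  have compl: "measure N (S \<inter> H (t + pi)) = measure N S - measure N (S \<inter> H t)" if "S \<in> sets borel" for S t
  proof -
    have "u (t + pi) = - u t" by (simp add: u_def)
    then have "H (t + pi) = {x. u t \<bullet> x \<le> u t \<bullet> c}" by (simp add: H_def)
    then show ?thesis using measure_half_space_le[OF that u0] by (simp add: H_def)
  qed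
  have bal: "measure N (A \<inter> K) = p * measure N K" using K by (simp add: balanced_def)
  have g_compl: "g (t + pi) = - g t" for t
    using bal compl[of "A \<inter> K" t] compl[of K t] by (simp add: g_def right_diff_distrib)
  have "\<exists>t\<ge>0. t \<le> pi \<and> g t = 0"
  proof (cases "g 0 \<le> 0")
    case True
    then show ?thesis
      using IVT[of g 0 0 pi] g_compl[of 0] cont by auto
  next
    case False
    then show ?thesis
      using IVT2[of g pi 0 0] g_compl[of 0] cont by auto
  qed
  then obtain t where t: "g t = 0" by blast
  have half: "balanced A B p q (K \<inter> H s)"
    if "g s = 0" "0 < measure N (K \<inter> H s)" "q * measure N (K \<inter> H s) \<le> measure N (B \<inter> (K \<inter> H s))" for s
  proof -
    have "closed (H s)" "convex (H s)"
      unfolding H_def by (simp_all add: closed_halfspace_ge convex_halfspace_ge)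
    then show ?thesis
      using K that by (auto simp: balanced_def g_def Int_assoc intro: compact_Int_closed convex_Int)
  qed
  have "\<exists>s. balanced A B p q (K \<inter> H s)"
  proof (rule ccontr)
    assume no: "\<nexists>s. balanced A B p q (K \<inter> H s)"
    \<comment> \<open>If both halves were null, or too poor in \<open>B\<close>, adding them up
      would contradict the balance of \<open>K\<close>; a null half contains nothing of
      \<open>B\<close> either.\<close>
    let ?bad = "\<lambda>s. measure N (K \<inter> H s) = 0 \<or> measure N (B \<inter> (K \<inter> H s)) < q * measure N (K \<inter> H s)"
    have "?bad s" if "g s = 0" for s
      using half[OF that] no measure_nonneg[of N "K \<inter> H s"] by (metis not_le order_le_less)
    from this[of t] this[of "t + pi"] have "?bad t" "?bad (t + pi)"
      using t g_compl[of t] by auto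
    moreover have sumK: "measure N (K \<inter> H (t + pi)) = measure N K - measure N (K \<inter> H t)"
      by (rule compl) simp
    moreover have sumB: "measure N (B \<inter> (K \<inter> H (t + pi))) = measure N (B \<inter> K) - measure N (B \<inter> (K \<inter> H t))"
      using compl[of "B \<inter> K" t] by (simp add: Int_assoc)
    moreover have "measure N (B \<inter> (K \<inter> H s)) \<le> measure N (K \<inter> H s)" for s
      by (rule finite_measure_mono) auto
    moreover have "0 < measure N K" "q * measure N K \<le> measure N (B \<inter> K)"
      using K by (auto simp: balanced_def)
    ultimately show False
      by (smt (verit, ccfv_SIG) measure_nonneg mult_zero_right right_diff_distrib)
  qed
  then obtain s where "balanced A B p q (K \<inter> H s)" by blast
  moreover have "planar_cut (K \<inter> H s) i j c"
    unfolding planar_cut_def H_def u_def by (intro exI[of _ "cos s"] exI[of _ "sin s"]) simp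
  ultimately show ?thesis using that[of "K \<inter> H s"] by simp
qed

lemma balanced_bisect_finite:
  assumes "finite I" and "balanced A B p q K" and meas: "A \<in> sets borel" "B \<in> sets borel"
    and "\<And>i j c. (i, j, c) \<in> I \<Longrightarrow> norm i = 1 \<and> norm j = 1 \<and> i \<bullet> j = 0"
  shows "\<exists>K'\<subseteq>K. balanced A B p q K' \<and> (\<forall>i j c. (i, j, c) \<in> I \<longrightarrow> planar_cut K' i j c)"
  using assms(1,2,5)
proof (induction I rule: finite_induct)
  case empty
  then show ?case by auto
next
  case (insert T I)
  obtain i j c where T: "T = (i, j, c)" by (rule prod_cases3[of T]) blast
  have "\<exists>K'\<subseteq>K. balanced A B p q K' \<and> (\<forall>i j c. (i, j, c) \<in> I \<longrightarrow> planar_cut K' i j c)"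
    using insert.prems by (intro insert.IH) auto
  then obtain K1 where K1: "K1 \<subseteq> K" "balanced A B p q K1"
    and K1': "\<And>i j c. (i, j, c) \<in> I \<Longrightarrow> planar_cut K1 i j c"
    by blast
  have "norm i = 1" "norm j = 1" "i \<bullet> j = 0" using insert.prems(2) T by auto
  then obtain K2 where K2: "K2 \<subseteq> K1" "balanced A B p q K2" "planar_cut K2 i j c"
    using balanced_bisect[OF K1(2) meas] by blast
  then have "planar_cut K2 i' j' c'" if "(i', j', c') \<in> insert T I" for i' j' c'
    using that T K1' planar_cut_subset[OF _ K2(1)] by blast
  then show ?case using K2 K1(1) by blast
qed

end

section \<open>Thinness from small two-by-two minors\<close>

text \<open>Lagrange's identity; the factor 2 comes from summing over ordered pairs. It converts
  bounds on the minors of two vectors into a bound on the distance of one of them from the line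
  spanned by the other.\<close>

lemma norm_sum_lagrange:
  fixes v w :: "'a::euclidean_space"
  shows "2 * ((norm v)\<^sup>2 * (norm w)\<^sup>2 - (v \<bullet> w)\<^sup>2)
    = (\<Sum>i\<in>Basis. \<Sum>j\<in>Basis. ((v \<bullet> i) * (w \<bullet> j) - (v \<bullet> j) * (w \<bullet> i))\<^sup>2)"
proof -
  have n: "(norm x)\<^sup>2 = (\<Sum>i\<in>Basis. (x \<bullet> i)\<^sup>2)" for x :: 'a
    unfolding power2_norm_eq_inner by (subst euclidean_inner) (simp only: power2_eq_square)
  have 1: "(norm v)\<^sup>2 * (norm w)\<^sup>2 = (\<Sum>i\<in>Basis. \<Sum>j\<in>Basis. ((v \<bullet> i) * (w \<bullet> j))\<^sup>2)"
    unfolding n sum_product by (simp add: power_mult_distrib)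
  have 2: "(norm v)\<^sup>2 * (norm w)\<^sup>2 = (\<Sum>i\<in>Basis. \<Sum>j\<in>Basis. ((v \<bullet> j) * (w \<bullet> i))\<^sup>2)"
    unfolding 1 by (rule sum.swap)
  have 3: "(v \<bullet> w)\<^sup>2 = (\<Sum>i\<in>Basis. \<Sum>j\<in>Basis. ((v \<bullet> i) * (w \<bullet> j)) * ((v \<bullet> j) * (w \<bullet> i)))"
    unfolding euclidean_inner[of v w] power2_eq_square sum_product by (simp add: mult_ac)
  have "(\<Sum>i\<in>Basis. \<Sum>j\<in>Basis. ((v \<bullet> i) * (w \<bullet> j) - (v \<bullet> j) * (w \<bullet> i))\<^sup>2)
    = (norm v)\<^sup>2 * (norm w)\<^sup>2 + (norm v)\<^sup>2 * (norm w)\<^sup>2 - 2 * (v \<bullet> w)\<^sup>2"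
    unfolding 3 by (subst 1, subst 2)
      (simp add: power2_diff sum.distrib sum_subtractf sum_distrib_left mult_ac)
  then show ?thesis by simp
qed

text \<open>
  A triangle that lies on one side of a line passing near its centroid is contained in a narrow
  strip, so its area is small.
\<close>

lemma planar_cut_minor_bound:
  fixes K :: "'a::euclidean_space set"
  assumes cut: "planar_cut K i j c" and ij: "norm i = 1" "norm j = 1" "i \<bullet> j = 0"
    and x: "x \<in> K" "y \<in> K" "z \<in> K" and near: "norm ((x + y + z) /\<^sub>R 3 - c) \<le> \<rho>"
    and R: "norm (y - x) \<le> R" "norm (z - x) \<le> R"
  shows "\<bar>((y - x) \<bullet> i) * ((z - x) \<bullet> j) - ((y - x) \<bullet> j) * ((z - x) \<bullet> i)\<bar> \<le> 12 * \<rho> * R"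
proof -
  obtain a b where ab: "a\<^sup>2 + b\<^sup>2 = 1" and cut': "\<And>x. x \<in> K \<Longrightarrow> (a *\<^sub>R i + b *\<^sub>R j) \<bullet> c \<le> (a *\<^sub>R i + b *\<^sub>R j) \<bullet> x"
    using cut unfolding planar_cut_def by blast
  define u where "u = a *\<^sub>R i + b *\<^sub>R j"
  have "(norm u)\<^sup>2 = a\<^sup>2 + b\<^sup>2"
    unfolding u_def power2_norm_eq_inner
    using ij by (simp add: norm_eq_1 inner_add_left inner_add_right inner_commute power2_eq_square)
  then have nu: "norm u = 1" using ab norm_ge_zero[of u] by (auto simp: power2_eq_1_iff)
  have ge: "0 \<le> u \<bullet> (x - c)" "0 \<le> u \<bullet> (y - c)" "0 \<le> u \<bullet> (z - c)"
    using cut' x by (auto simp: u_def inner_diff_right)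
  \<comment> \<open>Three nonnegative heights whose mean is at most \<rho>: each lies between 0 and
    \<open>3 * \<rho>\<close>, which confines the triangle to a strip.\<close>
  have "u \<bullet> (x - c) + u \<bullet> (y - c) + u \<bullet> (z - c) = 3 * (u \<bullet> ((x + y + z) /\<^sub>R 3 - c))"
    by (simp add: inner_diff_right inner_add_right)
  also have "u \<bullet> ((x + y + z) /\<^sub>R 3 - c) \<le> \<rho>"
    using norm_cauchy_schwarz[of u "(x + y + z) /\<^sub>R 3 - c"] near nu by simp
  finally have le: "u \<bullet> (x - c) + u \<bullet> (y - c) + u \<bullet> (z - c) \<le> 3 * \<rho>" by simp
  define v w where "v = y - x" and "w = z - x"
  have uv: "\<bar>u \<bullet> v\<bar> \<le> 3 * \<rho>" and uw: "\<bar>u \<bullet> w\<bar> \<le> 3 * \<rho>"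
    using ge le by (auto simp: v_def w_def inner_diff_right abs_le_iff)
  have coord: "\<bar>s \<bullet> e\<bar> \<le> R" if "norm s \<le> R" "norm e = 1" for s e :: 'a
    using Cauchy_Schwarz_ineq2[of s e] that by simp
  have vw: "\<bar>v \<bullet> i\<bar> \<le> R" "\<bar>v \<bullet> j\<bar> \<le> R" "\<bar>w \<bullet> i\<bar> \<le> R" "\<bar>w \<bullet> j\<bar> \<le> R"
    using coord R ij by (auto simp: v_def w_def)
  define m where "m = (v \<bullet> i) * (w \<bullet> j) - (v \<bullet> j) * (w \<bullet> i)"
  have u_exp: "u \<bullet> s = a * (s \<bullet> i) + b * (s \<bullet> j)" for s
    by (simp add: u_def inner_add_left inner_add_right inner_commute)
  \<comment> \<open>Cramer's rule. Each of the two products is at most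
    \<open>3 * \<rho> * R\<close>, and \<open>\<bar>a\<bar> + \<bar>b\<bar> \<ge> 1\<close> then
    yields the constant 12.\<close>
  have am: "a * m = (u \<bullet> v) * (w \<bullet> j) - (v \<bullet> j) * (u \<bullet> w)"
    and bm: "b * m = (v \<bullet> i) * (u \<bullet> w) - (u \<bullet> v) * (w \<bullet> i)"
    by (simp_all add: m_def u_exp algebra_simps)
  have prod: "\<bar>s * t\<bar> \<le> 3 * \<rho> * R" if "\<bar>s\<bar> \<le> 3 * \<rho>" "\<bar>t\<bar> \<le> R" for s t :: real
    unfolding abs_mult using that by (intro mult_mono) auto
  have "\<bar>a * m\<bar> \<le> 6 * \<rho> * R"
    unfolding am using prod[OF uv vw(4)] prod[OF uw vw(2)] by (simp add: mult.commute)
  moreover have "\<bar>b * m\<bar> \<le> 6 * \<rho> * R"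
    unfolding bm using prod[OF uw vw(1)] prod[OF uv vw(3)] by (simp add: mult.commute)
  moreover have "\<bar>m\<bar> \<le> \<bar>a * m\<bar> + \<bar>b * m\<bar>"
  proof -
    have "a\<^sup>2 \<le> 1" "b\<^sup>2 \<le> 1"
      using ab zero_le_power2[of a] zero_le_power2[of b] by linarith+
    then have "\<bar>a\<bar> \<le> 1" "\<bar>b\<bar> \<le> 1" by (simp_all add: abs_square_le_1)
    then have "a\<^sup>2 \<le> \<bar>a\<bar>" "b\<^sup>2 \<le> \<bar>b\<bar>"
      using mult_left_le[of "\<bar>a\<bar>" "\<bar>a\<bar>"] mult_left_le[of "\<bar>b\<bar>" "\<bar>b\<bar>"] by (auto simp: power2_eq_square)
    then have "1 \<le> \<bar>a\<bar> + \<bar>b\<bar>" using ab by linarith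
    then have "1 * \<bar>m\<bar> \<le> (\<bar>a\<bar> + \<bar>b\<bar>) * \<bar>m\<bar>" by (rule mult_right_mono) simp
    then show ?thesis by (simp add: abs_mult algebra_simps)
  qed
  ultimately show ?thesis unfolding m_def v_def w_def by linarith
qed

text \<open>The direction is that of \<open>y0 - x0\<close>, whose length is at least
  \<open>r\<close>. The squares of the minors, one for each ordered pair of basis vectors, sum to at
  most \<open>(r\<^sup>2 / 8)\<^sup>2\<close>, so every point of \<open>K\<close> is within
  \<open>r / 8\<close> of the line through \<open>x0\<close> and \<open>y0\<close>; two such
  deviations make \<open>r / 4\<close>.\<close>

lemma thin_of_small_minors:
  fixes K :: "'a::euclidean_space set"
  assumes minors: "\<And>x y z i j. x \<in> K \<Longrightarrow> y \<in> K \<Longrightarrow> z \<in> K \<Longrightarrow> i \<in> Basis \<Longrightarrow> j \<in> Basis \<Longrightarrow>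
      \<bar>((y - x) \<bullet> i) * ((z - x) \<bullet> j) - ((y - x) \<bullet> j) * ((z - x) \<bullet> i)\<bar> \<le> r\<^sup>2 / (8 * DIM('a))"
    and r: "0 < r" and x0: "x0 \<in> K" "y0 \<in> K" "r \<le> norm (y0 - x0)"
  obtains \<theta> where "norm \<theta> = 1" "\<And>x y. x \<in> K \<Longrightarrow> y \<in> K \<Longrightarrow> norm (x - y) \<le> \<bar>(x - y) \<bullet> \<theta>\<bar> + r / 4"
proof -
  define v where "v = y0 - x0"
  define \<theta> where "\<theta> = v /\<^sub>R norm v"
  have v: "r \<le> norm v" "0 < norm v" using x0(3) r by (auto simp: v_def)
  have \<theta>: "norm \<theta> = 1" using v(2) by (auto simp: \<theta>_def)
  define P where "P x = x - (x \<bullet> \<theta>) *\<^sub>R \<theta>" for x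
  have P2: "(norm (P w))\<^sup>2 = (norm w)\<^sup>2 - (w \<bullet> \<theta>)\<^sup>2" for w
    unfolding P_def power2_norm_eq_inner
    using \<theta> by (simp add: norm_eq_1 inner_diff_left inner_diff_right inner_commute power2_eq_square algebra_simps)
  have P: "norm (P (z - x0)) \<le> r / 8" if "z \<in> K" for z
  proof -
    let ?w = "z - x0"
    let ?D = "real DIM('a)"
    have "2 * ((norm v)\<^sup>2 * (norm ?w)\<^sup>2 - (v \<bullet> ?w)\<^sup>2)
        \<le> (\<Sum>i\<in>(Basis :: 'a set). \<Sum>j\<in>(Basis :: 'a set). (r\<^sup>2 / (8 * ?D))\<^sup>2)"
      unfolding norm_sum_lagrange
    proof (intro sum_mono)
      fix i j :: 'a assume "i \<in> Basis" "j \<in> Basis"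
      then have "\<bar>(v \<bullet> i) * (?w \<bullet> j) - (v \<bullet> j) * (?w \<bullet> i)\<bar>\<^sup>2 \<le> (r\<^sup>2 / (8 * ?D))\<^sup>2"
        unfolding v_def using minors[OF x0(1,2) that] by (intro power_mono) auto
      then show "((v \<bullet> i) * (?w \<bullet> j) - (v \<bullet> j) * (?w \<bullet> i))\<^sup>2 \<le> (r\<^sup>2 / (8 * ?D))\<^sup>2" by simp
    qed
    also have "\<dots> = (r\<^sup>2 / 8)\<^sup>2" by (simp add: power2_eq_square field_simps)
    finally have *: "2 * ((norm v)\<^sup>2 * (norm ?w)\<^sup>2 - (v \<bullet> ?w)\<^sup>2) \<le> (r\<^sup>2 / 8)\<^sup>2" .
    have "X \<le> Y" if "2 * X \<le> Y" "0 \<le> Y" for X Y :: real using that by linarith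
    from this[OF *] have "(norm v)\<^sup>2 * (norm ?w)\<^sup>2 - (v \<bullet> ?w)\<^sup>2 \<le> (r\<^sup>2 / 8)\<^sup>2" by simp
    moreover have "v \<bullet> ?w = norm v * (?w \<bullet> \<theta>)"
      using v(2) by (simp add: \<theta>_def inner_commute)
    ultimately have "(norm v * norm (P ?w))\<^sup>2 \<le> (r\<^sup>2 / 8)\<^sup>2"
      by (simp add: power_mult_distrib P2 right_diff_distrib)
    then have "norm v * norm (P ?w) \<le> r\<^sup>2 / 8"
      by (rule power2_le_imp_le) simp
    moreover have "r * norm (P ?w) \<le> norm v * norm (P ?w)" using v by (intro mult_right_mono) auto
    ultimately have "r * norm (P ?w) \<le> r * (r / 8)" by (simp add: power2_eq_square)
    then show ?thesis using r by (rule mult_left_le_imp_le)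
  qed
  have "norm (x - y) \<le> \<bar>(x - y) \<bullet> \<theta>\<bar> + r / 4" if "x \<in> K" "y \<in> K" for x y
  proof -
    have "x - y = ((x - y) \<bullet> \<theta>) *\<^sub>R \<theta> + (P (x - x0) - P (y - x0))"
      by (simp add: P_def inner_diff_left algebra_simps)
    then have "norm (x - y) \<le> norm (((x - y) \<bullet> \<theta>) *\<^sub>R \<theta>) + norm (P (x - x0) - P (y - x0))"
      by (metis norm_triangle_ineq)
    also have "norm (P (x - x0) - P (y - x0)) \<le> r / 8 + r / 8"
      using norm_triangle_ineq4[of "P (x - x0)" "P (y - x0)"] P[OF that(1)] P[OF that(2)] by linarith
    finally show ?thesis using \<theta> by simp
  qed
  with \<theta> that show ?thesis by blast
qed

context needle_measure begin

text \<open>Cut through every point of a finite \<rho>-net, once for each pair of distinct basis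
  vectors. The centroid of any triangle in the remaining convex body is near some point of the net,
  so all minors are small. Both \<open>A\<close> and \<open>B\<close> keep positive mass in the
  body, so it contains two points at distance at least \<open>r\<close>.\<close>

lemma ex_balanced_needle:
  assumes K: "balanced A B p q K" and meas: "A \<in> sets borel" "B \<in> sets borel"
    and pq: "0 < p" "0 < q" and r: "0 < r" and sep: "\<And>x y. x \<in> A \<Longrightarrow> y \<in> B \<Longrightarrow> r \<le> norm (x - y)"
  obtains K' \<theta> where "balanced A B p q K'" "norm \<theta> = 1"
    "\<And>x y. x \<in> K' \<Longrightarrow> y \<in> K' \<Longrightarrow> norm (x - y) \<le> \<bar>(x - y) \<bullet> \<theta>\<bar> + r / 4"
proof -
  have "compact K" using K by (simp add: balanced_def)
  then obtain R where R: "0 < R" "\<And>x. x \<in> K \<Longrightarrow> norm x \<le> R"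
    using compact_imp_bounded bounded_pos by metis
  \<comment> \<open>Chosen so that \<open>12 * \<rho> * (2 * R)\<close>, the minor bound for a body
    of diameter at most \<open>2 * R\<close>, is the bound that \<open>thin_of_small_minors\<close>
    asks for.\<close>
  define \<rho> where "\<rho> = r\<^sup>2 / (8 * DIM('a)) / (12 * (2 * R))"
  have \<rho>: "0 < \<rho>" using R r by (simp add: \<rho>_def)
  obtain C where C: "finite C" "cball (0::'a) R \<subseteq> (\<Union>c\<in>C. ball c \<rho>)"
    using compact_imp_seq_compact[OF compact_cball, THEN seq_compact_imp_totally_bounded] \<rho> by metis
  define I where "I = {(i, j, c). i \<in> (Basis::'a set) \<and> j \<in> (Basis::'a set) \<and> i \<noteq> j \<and> c \<in> C}"
  have "I \<subseteq> Basis \<times> Basis \<times> C" by (auto simp: I_def)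
  then have "finite I" by (rule finite_subset) (use C in auto)
  then obtain K' where K': "K' \<subseteq> K" "balanced A B p q K'" and cut: "\<And>i j c. (i, j, c) \<in> I \<Longrightarrow> planar_cut K' i j c"
    using balanced_bisect_finite[OF _ K meas, of I] by (fastforce simp: I_def inner_Basis)
  have "0 < measure N K'" using K' by (simp add: balanced_def)
  then have "0 < measure N (A \<inter> K')" "0 < measure N (B \<inter> K')"
    using K'(2) pq by (auto simp: balanced_def intro: less_le_trans[OF mult_pos_pos])
  then have "A \<inter> K' \<noteq> {}" "B \<inter> K' \<noteq> {}" by auto
  then obtain x0 y0 where xy0: "x0 \<in> A" "x0 \<in> K'" "y0 \<in> B" "y0 \<in> K'" by blast
  have conv: "convex K'" using K' by (simp add: balanced_def)
  have "\<bar>((y - x) \<bullet> i) * ((z - x) \<bullet> j) - ((y - x) \<bullet> j) * ((z - x) \<bullet> i)\<bar> \<le> r\<^sup>2 / (8 * DIM('a))"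
    if xyz: "x \<in> K'" "y \<in> K'" "z \<in> K'" and ij: "i \<in> Basis" "j \<in> Basis" for x y z i j
  proof (cases "i = j")
    case False
    define g where "g = (x + y + z) /\<^sub>R 3"
    have "(1/2) *\<^sub>R x + (1/2) *\<^sub>R y \<in> K'"
      using conv xyz by (intro convexD) auto
    then have "(2/3) *\<^sub>R ((1/2) *\<^sub>R x + (1/2) *\<^sub>R y) + (1/3) *\<^sub>R z \<in> K'"
      using conv xyz by (intro convexD) auto
    also have "(2/3) *\<^sub>R ((1/2) *\<^sub>R x + (1/2) *\<^sub>R y) + (1/3) *\<^sub>R z = (x + y + z) /\<^sub>R 3"
      by (simp add: scaleR_add_right inverse_eq_divide)
    finally have gK: "g \<in> K'" unfolding g_def .
    then have "g \<in> cball 0 R" using K'(1) R(2) by auto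
    then obtain c where c: "c \<in> C" "norm (g - c) < \<rho>"
      using C(2) by (auto simp: dist_norm norm_minus_commute)
    have nR: "norm (s - x) \<le> 2 * R" if "s \<in> K'" for s
    proof -
      have "norm s \<le> R" "norm x \<le> R" using R(2) K'(1) that xyz(1) by auto
      then show ?thesis using norm_triangle_ineq4[of s x] by linarith
    qed
    have "\<bar>((y - x) \<bullet> i) * ((z - x) \<bullet> j) - ((y - x) \<bullet> j) * ((z - x) \<bullet> i)\<bar> \<le> 12 * \<rho> * (2 * R)"
    proof (rule planar_cut_minor_bound)
      show "planar_cut K' i j c" using ij False c by (intro cut) (auto simp: I_def)
    qed (use ij False c xyz nR in \<open>auto simp: inner_Basis g_def\<close>)
    also have "\<dots> = r\<^sup>2 / (8 * DIM('a))" using R(1) by (simp add: \<rho>_def)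
    finally show ?thesis .
  qed (use r in simp)
  moreover have "r \<le> norm (y0 - x0)" using sep[OF xy0(1,3)] by (simp add: norm_minus_commute)
  ultimately obtain \<theta> where "norm \<theta> = 1" "\<And>x y. x \<in> K' \<Longrightarrow> y \<in> K' \<Longrightarrow> norm (x - y) \<le> \<bar>(x - y) \<bullet> \<theta>\<bar> + r / 4"
    using thin_of_small_minors[OF _ r xy0(2,4)] by metis
  with K'(2) that show ?thesis by blast
qed

end

section \<open>Neighbourhoods\<close>

text \<open>A nearest point of \<open>A\<close> lies in a cell of radius \<open>r / 4\<close> about
  one of countably many centres \<open>d\<close>, and the distance to that cell is again
  \<open>r\<close>. It remains to see that each set \<open>S d\<close> is negligible.\<close>

lemma negligible_infdist_eq:
  fixes A :: "'a::euclidean_space set"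
  assumes A: "closed A" and r: "0 < r"
  shows "negligible {x. infdist x A = r}"
proof -
  obtain D :: "'a set" where D: "countable D" "\<And>Y. open Y \<Longrightarrow> Y \<noteq> {} \<Longrightarrow> \<exists>d\<in>D. d \<in> Y"
    using countable_dense_setE by blast
  define S where "S d = {x. infdist x (A \<inter> cball d (r / 4)) = r}" for d
  have neg: "negligible (S d)" for d
  proof (cases "A \<inter> cball d (r / 4) = {}")
    case True
    then show ?thesis using r by (simp add: S_def infdist_def)
  next
    case False
    have cl: "closed (A \<inter> cball d (r / 4))" using A by auto
    show ?thesis
      \<comment> \<open>seen from \<open>d\<close>, which is much closer than \<open>r\<close> to all of the cell, every ray meets \<open>S d\<close> at most once\<close>
    proof (rule starlike_negligible_strong)
      show "closed (S d)"
        unfolding S_def by (intro closed_Collect_eq continuous_intros)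
      fix c :: real and x :: 'a assume c: "0 \<le> c" "c < 1" and "d + x \<in> S d"
      then have inf: "infdist (d + x) (A \<inter> cball d (r / 4)) = r" by (simp add: S_def)
      obtain a where a: "a \<in> A \<inter> cball d (r / 4)" "infdist (d + x) (A \<inter> cball d (r / 4)) = dist (d + x) a"
        using infdist_attains_inf[OF cl False] by blast
      have "d + c *\<^sub>R x - a = c *\<^sub>R (d + x - a) + (1 - c) *\<^sub>R (d - a)"
        by (simp add: algebra_simps)
      then have "norm (d + c *\<^sub>R x - a) \<le> norm (c *\<^sub>R (d + x - a)) + norm ((1 - c) *\<^sub>R (d - a))"
        by (metis norm_triangle_ineq)
      also have "\<dots> \<le> c * r + (1 - c) * (r / 4)"
        using a inf c by (intro add_mono) (auto simp: dist_norm intro!: mult_left_mono)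
      also have "\<dots> < r" using c r by (simp add: field_simps)
      finally have "infdist (d + c *\<^sub>R x) (A \<inter> cball d (r / 4)) < r"
        using infdist_le[OF a(1), of "d + c *\<^sub>R x"] by (simp add: dist_norm)
      then show "d + c *\<^sub>R x \<notin> S d" by (simp add: S_def)
    qed
  qed
  have "{x. infdist x A = r} \<subseteq> \<Union>(S ` D)"
  proof
    fix x assume "x \<in> {x. infdist x A = r}"
    then have x: "infdist x A = r" by simp
    then have "A \<noteq> {}" using r by (auto simp: infdist_def)
    then obtain a where a: "a \<in> A" "dist x a = r"
      using infdist_attains_inf[OF A, of x] x by metis
    obtain d where d: "d \<in> D" "d \<in> ball a (r / 4)" using D(2)[of "ball a (r / 4)"] r by auto
    have "infdist x (A \<inter> cball d (r / 4)) = r"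
    proof (rule antisym)
      show "infdist x (A \<inter> cball d (r / 4)) \<le> r"
        using a d by (intro infdist_le2[of a]) (auto simp: dist_commute)
      show "r \<le> infdist x (A \<inter> cball d (r / 4))"
      proof -
        have "a \<in> A \<inter> cball d (r / 4)" using a d by (auto simp: dist_commute)
        then have "A \<inter> cball d (r / 4) \<noteq> {}" by blast
        then show ?thesis using infdist_mono[of "A \<inter> cball d (r / 4)" A x] x by simp
      qed
    qed
    then show "x \<in> \<Union>(S ` D)" using d by (auto simp: S_def)
  qed
  moreover have "negligible (\<Union>(S ` D))"
    using D(1) neg by (intro negligible_countable_Union) auto
  ultimately show ?thesis by (rule negligible_subset[rotated])
qed

text \<open>\<open>neighbourhood A r\<close> differs from an open set only by a subset of the null
  set of points at distance exactly \<open>r\<close>.\<close>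

lemma neighbourhood_lebesgue:
  fixes A :: "'a::euclidean_space set"
  assumes r: "0 < r"
  shows "neighbourhood A r \<in> sets lebesgue"
proof (cases "A = {}")
  case False
  have cl: "infdist x (closure A) = infdist x A" for x
    by (simp add: infdist_eq_setdist)
  have 1: "neighbourhood A r \<subseteq> {x. infdist x A \<le> r}"
    by (auto simp: neighbourhood_def dist_norm norm_minus_commute intro: infdist_le2)
  have 2: "{x. infdist x A < r} \<subseteq> neighbourhood A r"
  proof
    fix x assume "x \<in> {x. infdist x A < r}"
    then obtain a where "a \<in> A" "dist x a < r"
      using False by (auto simp: infdist_notempty cINF_less_iff)
    then show "x \<in> neighbourhood A r"
      by (auto simp: neighbourhood_def dist_norm norm_minus_commute intro!: bexI[of _ a])
  qed
  have "open {x. infdist x A < r}"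
    by (intro open_Collect_less continuous_intros)
  then have "{x. infdist x A < r} \<in> sets lebesgue" by simp
  moreover have "neighbourhood A r \<inter> {x. infdist x A = r} \<in> sets lebesgue"
    using negligible_infdist_eq[of "closure A" r] r
    by (intro negligible_imp_sets) (auto simp: cl intro: negligible_subset)
  moreover have "neighbourhood A r = {x. infdist x A < r} \<union> (neighbourhood A r \<inter> {x. infdist x A = r})"
    using 1 2 by force
  ultimately show ?thesis by (metis sets.Un)
qed (simp add: neighbourhood_def)

lemma neighbourhood_mono: "A \<subseteq> B \<Longrightarrow> neighbourhood A r \<subseteq> neighbourhood B r"
  by (auto simp: neighbourhood_def)

lemma subset_neighbourhood: "0 \<le> r \<Longrightarrow> A \<subseteq> neighbourhood A r"
  by (auto simp: neighbourhood_def intro!: bexI)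

lemma closed_neighbourhood_compact:
  assumes "compact (A :: 'a::euclidean_space set)"
  shows "closed (neighbourhood A r)"
proof -
  have "neighbourhood A r = (\<Union>x\<in>A. \<Union>y\<in>cball 0 r. {x + y})"
  proof (intro equalityI subsetI)
    fix y assume "y \<in> neighbourhood A r"
    then obtain x where "x \<in> A" "norm (x - y) \<le> r" by (auto simp: neighbourhood_def)
    then show "y \<in> (\<Union>x\<in>A. \<Union>y\<in>cball 0 r. {x + y})"
      by (intro UN_I[of x] UN_I[of "y - x"]) (auto simp: norm_minus_commute)
  qed (force simp: neighbourhood_def)
  also have "closed \<dots>"
    by (intro compact_closed_sums assms closed_cball)
  finally show ?thesis .
qed

section \<open>Measures with a modulus of convexity\<close>

text \<open>\<open>g\<close> is a Borel version of the density. In \<open>g_modulus\<close> the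
  inequality for the potential is exponentiated, with \<open>x\<close> and \<open>y\<close> as the
  outer points; in this form it remains meaningful where \<open>g\<close> vanishes.\<close>

locale modulus_density =
  fixes g :: "'a::euclidean_space \<Rightarrow> real" and \<delta> :: "real \<Rightarrow> real"
  assumes g_meas [measurable]: "g \<in> borel_measurable borel"
    and g_nonneg: "0 \<le> g x"
    and g_total: "(\<integral>\<^sup>+ x. ennreal (g x) \<partial>lborel) = 1"
    and \<delta>_nonneg: "0 \<le> t \<Longrightarrow> 0 \<le> \<delta> t"
    and \<delta>_mono: "0 \<le> s \<Longrightarrow> s \<le> t \<Longrightarrow> \<delta> s \<le> \<delta> t"
    and g_modulus: "g x * g y * exp (\<delta> (norm (x - y) / 2)) \<le> (g ((x + y) /\<^sub>R 2))\<^sup>2"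
begin

definition N :: "'a measure" where
  "N = density lborel (\<lambda>x. ennreal (g x))"

lemma sets_N [measurable_cong, simp]: "sets N = sets borel"
  by (simp add: N_def)

lemma emeasure_N: "S \<in> sets borel \<Longrightarrow> emeasure N S = (\<integral>\<^sup>+ x. ennreal (g x) * indicator S x \<partial>lborel)"
  unfolding N_def by (subst emeasure_density) auto

sublocale prob_space N
  by standard (simp add: emeasure_N[of UNIV, simplified] g_total N_def emeasure_density)

sublocale needle_measure N
proof
  show "sets N = sets borel" by simp
  fix u :: 'a and c :: real assume u: "u \<noteq> 0"
  let ?H = "{x. u \<bullet> x = c}"
  have "?H \<in> sets borel" by (intro borel_closed closed_hyperplane)
  moreover have "negligible ?H" using u by (intro negligible_hyperplane) auto
  ultimately have "?H \<in> null_sets lborel"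
    by (simp add: negligible_iff_null_sets null_sets_completion_iff)
  then have "AE x in lborel. x \<notin> ?H" by (rule AE_not_in)
  then have "emeasure N ?H = 0"
    using \<open>?H \<in> sets borel\<close>
    by (subst emeasure_N) (auto simp: nn_integral_0_iff_AE elim!: eventually_mono)
  then show "measure N ?H = 0" by (simp add: measure_def)
qed

text \<open>Prekopa-Leindler for \<open>g\<close> restricted to the two slabs, with the constant
  factor attached to the first. Convexity of \<open>K\<close> keeps midpoints inside
  \<open>K\<close>, and the gap between the slabs bounds the distance of their points from
  below.\<close>

lemma measure_slabs:
  assumes K: "K \<in> sets borel" "convex K" and \<theta>: "norm \<theta> = 1" and abc: "a \<le> b" "b \<le> c" "c \<le> d"
  shows "measure N (K \<inter> {x. x \<bullet> \<theta> \<in> {a..b}}) * measure N (K \<inter> {x. x \<bullet> \<theta> \<in> {c..d}}) * exp (\<delta> ((c - b) / 2))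
    \<le> (measure N (K \<inter> {x. x \<bullet> \<theta> \<in> {(a + c) / 2..(b + d) / 2}}))\<^sup>2"
proof -
  let ?e = "exp (\<delta> ((c - b) / 2))"
  define S where "S s t = K \<inter> {x. x \<bullet> \<theta> \<in> {s..t}}" for s t
  have [measurable]: "S s t \<in> sets borel" for s t
    unfolding S_def using K(1) by measurable
  have em: "(\<integral>\<^sup>+ x. ennreal (g x * indicator (S s t) x) \<partial>lborel) = emeasure N (S s t)" for s t
    by (subst emeasure_N) (auto intro!: nn_integral_cong split: split_indicator)
  have "(\<integral>\<^sup>+ x. ennreal ?e * ennreal (g x * indicator (S a b) x) \<partial>lborel) * (\<integral>\<^sup>+ x. ennreal (g x * indicator (S c d) x) \<partial>lborel)
    \<le> (\<integral>\<^sup>+ x. ennreal (g x * indicator (S ((a + c) / 2) ((b + d) / 2)) x) \<partial>lborel)\<^sup>2"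
  proof (rule prekopa_leindler)
    fix x y
    show "ennreal ?e * ennreal (g x * indicator (S a b) x) * ennreal (g y * indicator (S c d) y)
        \<le> (ennreal (g ((x + y) /\<^sub>R 2) * indicator (S ((a + c) / 2) ((b + d) / 2)) ((x + y) /\<^sub>R 2)))\<^sup>2"
    proof (cases "x \<in> S a b \<and> y \<in> S c d")
      case True
      then have xy: "x \<in> K" "y \<in> K" "a \<le> x \<bullet> \<theta>" "x \<bullet> \<theta> \<le> b" "c \<le> y \<bullet> \<theta>" "y \<bullet> \<theta> \<le> d"
        by (auto simp: S_def)
      have "(1/2) *\<^sub>R x + (1/2) *\<^sub>R y \<in> K" using K(2) xy by (intro convexD) auto
      then have "(x + y) /\<^sub>R 2 \<in> K" by (simp add: scaleR_add_right inverse_eq_divide)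
      then have mid: "(x + y) /\<^sub>R 2 \<in> S ((a + c) / 2) ((b + d) / 2)"
        using xy by (simp add: S_def inner_add_left)
      have "c - b \<le> (y - x) \<bullet> \<theta>" using xy by (simp add: inner_diff_left)
      also have "\<dots> \<le> norm (x - y)"
        using norm_cauchy_schwarz[of "y - x" \<theta>] \<theta> by (simp add: norm_minus_commute)
      finally have "\<delta> ((c - b) / 2) \<le> \<delta> (norm (x - y) / 2)" using abc by (intro \<delta>_mono) auto
      then have "?e * (g x * g y) \<le> exp (\<delta> (norm (x - y) / 2)) * (g x * g y)"
        using g_nonneg by (intro mult_right_mono) auto
      also have "\<dots> \<le> (g ((x + y) /\<^sub>R 2))\<^sup>2" using g_modulus[of x y] by (simp add: mult_ac)
      finally have "ennreal (?e * (g x * g y)) \<le> ennreal ((g ((x + y) /\<^sub>R 2))\<^sup>2)" by (rule ennreal_leI)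
      then show ?thesis using True mid g_nonneg
        by (simp add: ennreal_mult ennreal_power mult_ac)
    qed auto
  qed measurable
  then have "ennreal ?e * emeasure N (S a b) * emeasure N (S c d) \<le> (emeasure N (S ((a + c) / 2) ((b + d) / 2)))\<^sup>2"
    by (simp add: em nn_integral_cmult)
  then have "ennreal (?e * measure N (S a b) * measure N (S c d)) \<le> ennreal ((measure N (S ((a + c) / 2) ((b + d) / 2)))\<^sup>2)"
    by (simp add: emeasure_eq_measure ennreal_mult ennreal_power)
  then show ?thesis
    unfolding S_def by (subst (asm) ennreal_le_iff) (auto simp: mult_ac)
qed

definition marginal :: "'a set \<Rightarrow> 'a \<Rightarrow> real measure" where
  "marginal K \<theta> = distr (uniform_measure N K) borel (\<lambda>x. x \<bullet> \<theta>)"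

lemma measure_marginal:
  assumes "K \<in> sets borel" "0 < measure N K" "S \<in> sets borel"
  shows "measure (marginal K \<theta>) S = measure N (K \<inter> {x. x \<bullet> \<theta> \<in> S}) / measure N K"
proof -
  have "measure (marginal K \<theta>) S = measure (uniform_measure N K) ((\<lambda>x. x \<bullet> \<theta>) -` S \<inter> space (uniform_measure N K))"
    unfolding marginal_def using assms by (intro measure_distr) auto
  also have "(\<lambda>x. x \<bullet> \<theta>) -` S \<inter> space (uniform_measure N K) = {x. x \<bullet> \<theta> \<in> S}" by auto
  also have "measure (uniform_measure N K) {x. x \<bullet> \<theta> \<in> S} = measure N (K \<inter> {x. x \<bullet> \<theta> \<in> S}) / measure N K"
  proof (rule measure_uniform_measure)
    have "(\<lambda>x. x \<bullet> \<theta>) -` S \<inter> space borel \<in> sets borel"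
      by (rule measurable_sets[OF _ assms(3)]) simp
    then show "{x. x \<bullet> \<theta> \<in> S} \<in> sets N" by (simp add: vimage_def)
  qed (use assms in \<open>auto simp: emeasure_eq_measure\<close>)
  finally show ?thesis .
qed

lemma marginal_real_distribution:
  assumes "K \<in> sets borel" "0 < measure N K"
  shows "real_distribution (marginal K \<theta>)"
proof -
  have "prob_space (uniform_measure N K)"
    using assms by (intro prob_space_uniform_measure) (auto simp: emeasure_eq_measure)
  then show ?thesis
    unfolding marginal_def by (intro prob_space.real_distribution_distr) auto
qed

lemma marginal_no_atoms:
  assumes "K \<in> sets borel" "0 < measure N K" "\<theta> \<noteq> 0"
  shows "measure (marginal K \<theta>) {x} = 0"
proof -
  have "measure N (K \<inter> {y. y \<bullet> \<theta> \<in> {x}}) \<le> measure N {y. \<theta> \<bullet> y = x}"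
    using assms by (intro finite_measure_mono) (auto simp: inner_commute intro!: borel_closed closed_hyperplane)
  then show ?thesis
    using hyperplane_null[OF assms(3)] assms by (simp add: measure_marginal measure_le_0_iff)
qed

lemma marginal_log_concave_cdf:
  assumes K: "compact K" "convex K" "0 < measure N K" and \<theta>: "norm \<theta> = 1"
  obtains \<alpha> \<beta> where "log_concave_cdf (cdf (marginal K \<theta>)) \<alpha> \<beta> \<delta>"
proof -
  have Km: "K \<in> sets borel" using K by (auto intro: borel_compact)
  interpret M: real_distribution "marginal K \<theta>"
    by (rule marginal_real_distribution[OF Km K(3)])
  have \<theta>0: "\<theta> \<noteq> 0" using \<theta> by auto
  note atoms = marginal_no_atoms[OF Km K(3) \<theta>0]
  obtain R where R: "\<And>x. x \<in> K \<Longrightarrow> norm x \<le> R"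
    using compact_imp_bounded[OF K(1)] bounded_iff by metis
  have xR: "\<bar>x \<bullet> \<theta>\<bar> \<le> R" if "x \<in> K" for x
    using Cauchy_Schwarz_ineq2[of x \<theta>] R[OF that] \<theta> by simp
  note Icc = M.measure_Icc_no_atoms[OF atoms]
  \<comment> \<open>The extra 1 makes the lower half-line miss \<open>K\<close> altogether.\<close>
  have "log_concave_cdf (cdf (marginal K \<theta>)) (- R - 1) R \<delta>"
  proof
    show "cdf (marginal K \<theta>) x \<le> cdf (marginal K \<theta>) y" if "x \<le> y" for x y
      using that by (rule M.cdf_nondecreasing)
    show "continuous_on UNIV (cdf (marginal K \<theta>))"
      by (simp add: continuous_at_imp_continuous_on M.isCont_cdf atoms)
    have "K \<inter> {x. x \<bullet> \<theta> \<in> {..- R - 1}} = {}" using xR by force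
    then show "cdf (marginal K \<theta>) (- R - 1) = 0"
      unfolding cdf_def by (subst measure_marginal[OF Km K(3)]) auto
    have "K \<inter> {x. x \<bullet> \<theta> \<in> {..R}} = K" using xR by force
    then show "cdf (marginal K \<theta>) R = 1"
      unfolding cdf_def using K(3) by (subst measure_marginal[OF Km K(3)]) auto
    fix a b c d :: real assume abc: "a \<le> b" "b \<le> c" "c \<le> d"
    let ?n = "measure N K" and ?s = "\<lambda>a b. measure N (K \<inter> {x. x \<bullet> \<theta> \<in> {a..b}})"
    have s: "cdf (marginal K \<theta>) b - cdf (marginal K \<theta>) a = ?s a b / ?n" if "a \<le> b" for a b
      using measure_marginal[OF Km K(3), of "{a..b}" \<theta>] Icc[OF that] by simp
    have "?s a b / ?n * (?s c d / ?n) * exp (\<delta> ((c - b) / 2)) = ?s a b * ?s c d * exp (\<delta> ((c - b) / 2)) / ?n\<^sup>2"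
      by (simp add: power2_eq_square)
    also have "\<dots> \<le> (?s ((a + c) / 2) ((b + d) / 2))\<^sup>2 / ?n\<^sup>2"
      by (intro divide_right_mono measure_slabs Km K \<theta> abc) auto
    also have "\<dots> = (?s ((a + c) / 2) ((b + d) / 2) / ?n)\<^sup>2" by (simp add: power_divide)
    finally show "(cdf (marginal K \<theta>) b - cdf (marginal K \<theta>) a) * (cdf (marginal K \<theta>) d - cdf (marginal K \<theta>) c) * exp (\<delta> ((c - b) / 2))
        \<le> (cdf (marginal K \<theta>) ((b + d) / 2) - cdf (marginal K \<theta>) ((a + c) / 2))\<^sup>2"
      using abc by (simp add: s)
  qed (auto intro: \<delta>_nonneg \<delta>_mono)
  then show ?thesis by (rule that)
qed

lemma marginal_half_line_enlargement:
  assumes K: "compact K" "convex K" "0 < measure N K" and \<theta>: "norm \<theta> = 1" and r: "0 < r"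
    and k: "0 \<le> k" "k\<^sup>2 \<le> \<delta> (r / 8)"
  shows "half_line_enlargement (marginal K \<theta>) k (3 * r / 4)"
proof -
  have Km: "K \<in> sets borel" using K by (auto intro: borel_compact)
  interpret M: real_distribution "marginal K \<theta>"
    by (rule marginal_real_distribution[OF Km K(3)])
  have \<theta>0: "\<theta> \<noteq> 0" using \<theta> by auto
  obtain \<alpha> \<beta> where "log_concave_cdf (cdf (marginal K \<theta>)) \<alpha> \<beta> \<delta>"
    using marginal_log_concave_cdf[OF K \<theta>] .
  then interpret F: log_concave_cdf "cdf (marginal K \<theta>)" \<alpha> \<beta> \<delta> .
  show ?thesis
  proof
    show "measure (marginal K \<theta>) {x} = 0" for x by (rule marginal_no_atoms[OF Km K(3) \<theta>0])
    fix u
    let ?F = "cdf (marginal K \<theta>)"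
    have b: "0 \<le> ?F x" "?F x \<le> 1" for x
      by (auto simp: cdf_def)
    have mono: "?F u \<le> ?F (u + 3 * r / 4)" using r by (intro M.cdf_nondecreasing) simp
    show "gauss_enlarge k (?F u) \<le> ?F (u + 3 * r / 4)"
    proof (cases rule: unit_interval_gcdf_cases[OF b(1,2)[of u]])
      case 1
      then show ?thesis using b by simp
    next
      case 2
      then show ?thesis using mono by simp
    next
      case (3 x)
      note x = this
      show ?thesis
      proof (cases rule: unit_interval_gcdf_cases[OF b(1,2)[of "u + 3 * r / 4"]])
        case 1
        then show ?thesis using mono x gcdf_pos[of x] by simp
      next
        case 2
        then show ?thesis using gauss_enlarge_bounds by simp
      next
        case (3 y)
        \<comment> \<open>The separation lemma needs a number strictly below the gap
          \<open>3 * r / 4\<close>; \<open>r / 2\<close> is taken, and its quarter is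
          \<open>r / 8\<close>.\<close>
        have "\<delta> (r / 2 / 4) \<le> (y - x)\<^sup>2" "x < y"
          using F.half_line_separation[OF x 3, of "r / 2"] r by auto
        then have "\<delta> (r / 8) \<le> (y - x)\<^sup>2" by simp
        with k(2) have "k\<^sup>2 \<le> (y - x)\<^sup>2" by (rule order_trans)
        then have "k \<le> y - x" by (rule power2_le_imp_le) (use \<open>x < y\<close> in simp)
        then show ?thesis using x 3 by simp
      qed
    qed
  qed (use r k in auto)
qed

text \<open>On a thin body, points at distance \<open>r\<close> have projections at distance
  \<open>3 * r / 4\<close>. Projecting \<open>A\<close> and \<open>B\<close> can only increase their
  proportions, because each set is contained in the preimage of its projection.\<close>

lemma balanced_needle_bound:
  assumes bal: "balanced A B p q K" and A: "compact A" and B: "compact B" and \<theta>: "norm \<theta> = 1"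
    and thin: "\<And>x y. x \<in> K \<Longrightarrow> y \<in> K \<Longrightarrow> norm (x - y) \<le> \<bar>(x - y) \<bullet> \<theta>\<bar> + r / 4"
    and sep: "\<And>x y. x \<in> A \<Longrightarrow> y \<in> B \<Longrightarrow> r \<le> norm (x - y)"
    and r: "0 < r" and k: "0 \<le> k" "k\<^sup>2 \<le> \<delta> (r / 8)" and p: "0 \<le> p"
  shows "gauss_enlarge k p \<le> 1 - q"
proof -
  have K: "compact K" "convex K" "0 < measure N K" using bal by (auto simp: balanced_def)
  have Km: "K \<in> sets borel" using K by (auto intro: borel_compact)
  interpret M: half_line_enlargement "marginal K \<theta>" k "3 * r / 4"
    by (rule marginal_half_line_enlargement[OF K \<theta> r k])
  define P where "P S = (\<lambda>x. x \<bullet> \<theta>) ` (S \<inter> K)" for S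
  have cP: "compact (P S)" if "compact S" for S
    unfolding P_def using that K by (intro compact_continuous_image continuous_intros compact_Int)
  have mP: "measure N (S \<inter> K) / measure N K \<le> measure (marginal K \<theta>) (P S)" if S: "compact S" for S
  proof -
    have m: "P S \<in> sets borel" by (rule borel_compact[OF cP[OF S]])
    have "(\<lambda>x. x \<bullet> \<theta>) -` P S \<inter> space borel \<in> sets borel"
      by (rule measurable_sets[OF _ m]) simp
    then have "measure N (S \<inter> K) \<le> measure N (K \<inter> {x. x \<bullet> \<theta> \<in> P S})"
      using Km by (intro finite_measure_mono) (auto simp: P_def vimage_def)
    then show ?thesis using measure_marginal[OF Km K(3) m] K(3) by (simp add: divide_right_mono)
  qed
  have "p \<le> measure N (A \<inter> K) / measure N K"
    using bal by (auto simp: balanced_def field_simps)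
  also note mP[OF A]
  finally have p': "p \<le> measure (marginal K \<theta>) (P A)" .
  have "q \<le> measure N (B \<inter> K) / measure N K"
    using bal by (auto simp: balanced_def field_simps)
  also note mP[OF B]
  finally have q': "q \<le> measure (marginal K \<theta>) (P B)" .
  have "gauss_enlarge k p \<le> gauss_enlarge k (measure (marginal K \<theta>) (P A))"
    using p p' by (intro gauss_enlarge_mono) auto
  also have "\<dots> \<le> 1 - measure (marginal K \<theta>) (P B)"
  proof (rule M.compact_enlargement)
    fix a b assume "a \<in> P A" "b \<in> P B"
    then obtain x y where "x \<in> A" "x \<in> K" "y \<in> B" "y \<in> K" "a = x \<bullet> \<theta>" "b = y \<bullet> \<theta>"
      by (auto simp: P_def)
    then show "3 * r / 4 \<le> \<bar>a - b\<bar>"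
      using sep[of x y] thin[of x y] by (simp add: inner_diff_left)
  qed (use cP A B in \<open>auto intro: compact_imp_closed\<close>)
  finally show ?thesis using q' by simp
qed

lemma compact_separation:
  assumes A: "compact A" and B: "compact B"
    and sep: "\<And>x y. x \<in> A \<Longrightarrow> y \<in> B \<Longrightarrow> r \<le> norm (x - y)"
    and r: "0 < r" and k: "0 \<le> k" "k\<^sup>2 \<le> \<delta> (r / 8)"
  shows "gauss_enlarge k (measure N A) \<le> 1 - measure N B"
proof (cases "measure N A = 0 \<or> measure N B = 0")
  case True
  then show ?thesis using gauss_enlarge_bounds[of k "measure N A"] prob_le_1[of B] by auto
next
  case False
  then have pos: "0 < measure N A" "0 < measure N B" using measure_nonneg[of N] by (auto simp: less_le)
  have m: "A \<in> sets borel" "B \<in> sets borel" using A B by (auto intro: borel_compact)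
  have "bounded (A \<union> B)" using A B by (simp add: compact_imp_bounded)
  then obtain R where "\<forall>x\<in>A \<union> B. norm x \<le> R"
    unfolding bounded_iff by blast
  then have R: "A \<union> B \<subseteq> cball 0 R" by auto
  let ?K = "cball (0::'a) R"
  have "measure N A \<le> measure N ?K" using R by (intro finite_measure_mono) auto
  then have K: "0 < measure N ?K" using pos by simp
  \<comment> \<open>The total mass is 1, so these proportions are at least the measures themselves
    and a bound for them is enough.\<close>
  define p q where "p = measure N A / measure N ?K" and "q = measure N B / measure N ?K"
  have "A \<inter> ?K = A" "B \<inter> ?K = B" using R by auto
  then have "balanced A B p q ?K"
    using K by (simp add: balanced_def p_def q_def)
  moreover have "0 < p" "0 < q" using pos K by (simp_all add: p_def q_def)
  ultimately obtain K' \<theta> where "balanced A B p q K'" "norm \<theta> = 1"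
    "\<And>x y. x \<in> K' \<Longrightarrow> y \<in> K' \<Longrightarrow> norm (x - y) \<le> \<bar>(x - y) \<bullet> \<theta>\<bar> + r / 4"
    using ex_balanced_needle[OF _ m _ _ r sep] by metis
  then have bound: "gauss_enlarge k p \<le> 1 - q"
    using balanced_needle_bound[OF _ A B _ _ sep r k] \<open>0 < p\<close> by (simp add: less_imp_le)
  have "measure N A \<le> p" "measure N B \<le> q"
    using K pos prob_le_1[of ?K] by (simp_all add: p_def q_def field_simps)
  moreover have "p \<le> 1" using \<open>measure N A \<le> measure N ?K\<close> K by (simp add: p_def)
  ultimately have "gauss_enlarge k (measure N A) \<le> gauss_enlarge k p"
    by (intro gauss_enlarge_mono) auto
  then show ?thesis using bound \<open>measure N B \<le> q\<close> by linarith
qed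

lemma ex_compact_approx:
  assumes "S \<in> sets borel" "t < measure N S"
  obtains C where "compact C" "C \<subseteq> S" "t < measure N C"
proof -
  have "emeasure N S = (SUP K \<in> {K. K \<subseteq> S \<and> compact K}. emeasure N K)"
    using assms by (intro inner_regular) auto
  moreover have "ennreal t < emeasure N S \<or> t < 0"
    using assms(2) by (auto simp: emeasure_eq_measure ennreal_less_iff)
  ultimately have "(\<exists>K. K \<subseteq> S \<and> compact K \<and> ennreal t < emeasure N K) \<or> t < 0"
    by (auto simp: less_SUP_iff)
  then show ?thesis
  proof
    assume "\<exists>K. K \<subseteq> S \<and> compact K \<and> ennreal t < emeasure N K"
    then obtain K where K: "K \<subseteq> S" "compact K" "ennreal t < emeasure N K" by blast
    then have "t < measure N K"
      by (cases "0 \<le> t") (auto simp: emeasure_eq_measure ennreal_less_iff intro: less_le_trans[OF _ measure_nonneg])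
    with K that show ?thesis by blast
  next
    assume "t < 0"
    with that[of "{}"] show ?thesis by simp
  qed
qed

text \<open>A failure would leave too much mass outside the neighbourhood; a compact part
  \<open>B\<close> of that mass, at distance more than \<open>r\<close> from \<open>A\<close>,
  contradicts \<open>compact_separation\<close>.\<close>

lemma neighbourhood_compact_enlargement:
  assumes A: "compact A" and r: "0 < r" and k: "0 \<le> k" "k\<^sup>2 \<le> \<delta> (r / 8)"
  shows "gauss_enlarge k (measure N A) \<le> measure N (neighbourhood A r)"
proof (rule ccontr)
  let ?A = "neighbourhood A r"
  have m: "?A \<in> sets borel" using closed_neighbourhood_compact[OF A] by simp
  have c: "measure N (- ?A) = 1 - measure N ?A"
    using prob_compl[of ?A] m by (simp add: Compl_eq_Diff_UNIV)
  assume "\<not> ?thesis"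
  then have "1 - gauss_enlarge k (measure N A) < measure N (- ?A)" by (simp add: c)
  then obtain B where B: "compact B" "B \<subseteq> - ?A" "1 - gauss_enlarge k (measure N A) < measure N B"
    using ex_compact_approx[OF borel_comp[OF m]] by blast
  have "r \<le> norm (x - y)" if "x \<in> A" "y \<in> B" for x y
    using that B(2) by (force simp: neighbourhood_def)
  then have "gauss_enlarge k (measure N A) \<le> 1 - measure N B"
    by (rule compact_separation[OF A B(1) _ r k])
  then show False using B(3) by simp
qed

text \<open>The number \<open>X\<close> stands for the completed measure of the neighbourhood of
  \<open>A\<close>, which need not be Borel; the measure \<open>N\<close> sees only the
  neighbourhoods of compact subsets.\<close>

lemma neighbourhood_enlargement:
  assumes A: "A \<in> sets borel" and r: "0 < r" and k: "0 \<le> k" "k\<^sup>2 \<le> \<delta> (r / 8)"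
    and X: "\<And>C. compact C \<Longrightarrow> C \<subseteq> A \<Longrightarrow> measure N (neighbourhood C r) \<le> X"
    and AX: "measure N A \<le> X"
  shows "gauss_enlarge k (measure N A) \<le> X"
proof (cases rule: unit_interval_gcdf_cases[OF measure_nonneg prob_le_1[of A]])
  case (3 z)
  show ?thesis
  proof (rule ccontr)
    assume "\<not> ?thesis"
    then have "X < gcdf (z + k)" using 3 by simp
    moreover have "0 < X" using AX 3 gcdf_pos[of z] by linarith
    ultimately obtain w where w: "X = gcdf w"
      using gcdf_surj[of X] gcdf_less_1[of "z + k"] by (metis less_trans)
    with \<open>X < gcdf (z + k)\<close> have wz: "w < z + k" by simp
    \<comment> \<open>Since \<open>y < z\<close>, some compact \<open>C\<close> has mass above
      \<Phi>(y); since \<open>w < y + k\<close>, the enlargement of \<Phi>(y) still exceeds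
      \<open>X\<close>.\<close>
    define y where "y = (w - k + z) / 2"
    have y: "y < z" "w < y + k" using wz by (auto simp: y_def field_simps)
    then have "gcdf y < measure N A" using 3 by simp
    then obtain C where C: "compact C" "C \<subseteq> A" "gcdf y < measure N C"
      using ex_compact_approx[OF A] by blast
    have "gcdf (y + k) = gauss_enlarge k (gcdf y)" by simp
    also have "\<dots> \<le> gauss_enlarge k (measure N C)"
      using C(3) by (intro gauss_enlarge_mono) (auto simp: less_imp_le)
    also have "\<dots> \<le> measure N (neighbourhood C r)"
      by (rule neighbourhood_compact_enlargement[OF C(1) r k])
    also have "\<dots> \<le> X" by (rule X[OF C(1,2)])
    finally show False using w y by simp
  qed
qed (use AX measure_nonneg[of N A] in auto)

end

section \<open>From the extended-real potential to a Borel density\<close>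

lemma std_normal_cdf_shift:
  assumes "0 \<le> p" "p \<le> 1"
  shows "std_normal_cdf (inv std_normal_cdf p + ereal k) = gauss_enlarge k p"
  by (cases rule: unit_interval_gcdf_cases[OF assms])
    (auto simp: inv_std_normal_cdf std_normal_cdf_ereal std_normal_cdf_infinity std_normal_cdf_minus_infinity)

theorem corollary5p3:
  fixes W :: "real ^ 'd \<Rightarrow> ereal"
    and \<nu> :: "(real ^ 'd) measure"
    and \<delta> :: "real \<Rightarrow> real"
  assumes nu: "\<nu> = exp_measure W" "prob_space \<nu>"
    and log_concave: "convex_ereal W"
    and support: "emeasure lebesgue {x. W x < \<infinity>} > 0"
    and delta_nonneg: "\<And>t. t \<ge> 0 \<Longrightarrow> \<delta> t \<ge> 0"
    and delta_mono: "mono_on {0..} \<delta>"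
    and W_delta: "\<And>x y. W x < \<infinity> \<Longrightarrow> W (x + y) + W (x - y) - 2 * W x \<ge> ereal (\<delta> (norm y))"
  shows "(\<forall>A\<in>sets borel. \<forall>r>0.
            measure \<nu> (neighbourhood A r)
              \<ge> std_normal_cdf (inv std_normal_cdf (measure \<nu> A) + ereal (1 / 2 * sqrt (\<delta> (r / 8)))))
       \<and> (\<forall>A\<in>sets borel. measure \<nu> A \<ge> 1 / 2 \<longrightarrow> (\<forall>r>0.
            measure \<nu> (neighbourhood A r) \<ge> 1 - 1 / 2 * exp (- (1 / 8) * \<delta> (r / 8))))"
proof -
  define D where "D = {x. W x < \<infinity>}"
  have D: "convex D" and conv: "convex_on D (\<lambda>x. real_of_ereal (W x))" and nminf: "W x \<noteq> -\<infinity>" for x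
    using log_concave by (auto simp: convex_ereal_def D_def convex_on_def)
  have Wreal: "W x = ereal (real_of_ereal (W x))" if "x \<in> D" for x
    using that nminf[of x] by (cases "W x") (auto simp: D_def)
  \<comment> \<open>On the interior of its domain a finite convex function is continuous, so
    \<open>g\<close> is Borel; the boundary of a convex set is negligible.\<close>
  define g where "g x = indicator (interior D) x * exp (- real_of_ereal (W x))" for x
  have g_meas [measurable]: "g \<in> borel_measurable borel"
  proof -
    have "continuous_on (interior D) (\<lambda>x. real_of_ereal (W x))"
      by (intro convex_on_continuous convex_on_subset[OF conv] convex_interior D interior_subset open_interior)
    then have "(\<lambda>x. indicator (interior D) x *\<^sub>R exp (- real_of_ereal (W x))) \<in> borel_measurable borel"
      by (intro borel_measurable_continuous_on_indicator continuous_intros) auto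
    then show ?thesis by (simp add: g_def[abs_def])
  qed
  have AE_g: "AE x in lebesgue. exp_uminus (W x) = ennreal (g x)"
  proof -
    have "frontier D \<in> null_sets lebesgue"
      using negligible_convex_frontier[OF D] by (simp add: negligible_iff_null_sets)
    then have "AE x in lebesgue. x \<notin> frontier D" by (rule AE_not_in)
    then show ?thesis
    proof eventually_elim
      case (elim x)
      show ?case
      proof (cases "x \<in> interior D")
        case True
        then have "x \<in> D" using interior_subset by blast
        from Wreal[OF this] obtain u where "W x = ereal u" by blast
        then show ?thesis using True by (simp add: g_def exp_uminus_def)
      next
        case False
        then have "x \<notin> D" using elim closure_subset[of D] by (auto simp: frontier_def)
        then have "W x = \<infinity>" by (simp add: D_def)
        then show ?thesis using False by (simp add: g_def exp_uminus_def)
      qed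
    qed
  qed
  \<comment> \<open>On the boundary of \<open>D\<close> the potential may be badly behaved, but
    equality almost everywhere with \<open>g\<close> is enough for measurability in the completed
    space.\<close>
  have W_meas: "(\<lambda>x. exp_uminus (W x)) \<in> borel_measurable lebesgue"
  proof (rule measurableI)
    fix S :: "ennreal set" assume S: "S \<in> sets borel"
    have "(\<lambda>x. ennreal (g x)) \<in> borel_measurable lebesgue" by (intro measurable_completion) simp
    from measurable_sets[OF this S] have 1: "(\<lambda>x. ennreal (g x)) -` S \<in> sets lebesgue" by simp
    have 2: "AE x in lebesgue. x \<in> (\<lambda>x. ennreal (g x)) -` S \<longleftrightarrow> x \<in> (\<lambda>x. exp_uminus (W x)) -` S"
      using AE_g by eventually_elim simp
    show "(\<lambda>x. exp_uminus (W x)) -` S \<inter> space lebesgue \<in> sets lebesgue"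
      using completion.in_sets_AE[OF 2 1] by simp
  qed simp
  have \<nu>_sets: "sets \<nu> = sets lebesgue" by (simp add: nu(1) exp_measure_def)
  have em: "emeasure \<nu> S = (\<integral>\<^sup>+ x. ennreal (g x) * indicator S x \<partial>lebesgue)" if "S \<in> sets lebesgue" for S
  proof -
    have "emeasure \<nu> S = (\<integral>\<^sup>+ x. exp_uminus (W x) * indicator S x \<partial>lebesgue)"
      unfolding nu(1) exp_measure_def using W_meas that by (rule emeasure_density)
    also have "\<dots> = (\<integral>\<^sup>+ x. ennreal (g x) * indicator S x \<partial>lebesgue)"
      using AE_g by (intro nn_integral_cong_AE) (auto elim!: eventually_mono)
    finally show ?thesis .
  qed
  interpret \<nu>: prob_space \<nu> by (rule nu(2))
  have \<delta>_mono: "\<delta> s \<le> \<delta> t" if "0 \<le> s" "s \<le> t" for s t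
    using delta_mono that by (auto simp: mono_on_def)
  interpret modulus_density g \<delta>
  proof
    show "0 \<le> g x" for x by (simp add: g_def)
    have "(\<integral>\<^sup>+ x. ennreal (g x) \<partial>lborel) = emeasure \<nu> UNIV"
      using em[of UNIV] by (simp add: nn_integral_completion)
    also have "\<dots> = 1"
      using \<nu>.emeasure_space_1 by (simp add: nu(1) exp_measure_def)
    finally show "(\<integral>\<^sup>+ x. ennreal (g x) \<partial>lborel) = 1" .
    show "g x * g y * exp (\<delta> (norm (x - y) / 2)) \<le> (g ((x + y) /\<^sub>R 2))\<^sup>2" for x y
    proof (cases "x \<in> interior D \<and> y \<in> interior D")
      case True
      \<comment> \<open>The hypothesis on \<open>W\<close> is centred: it is used at the midpoint
        \<open>m\<close> with the half-difference \<open>h\<close>.\<close>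
      define m where "m = (x + y) /\<^sub>R 2"
      define h where "h = (x - y) /\<^sub>R 2"
      have "(1/2) *\<^sub>R x + (1/2) *\<^sub>R y \<in> interior D"
        using convex_interior[OF D] True by (intro convexD) auto
      then have m: "m \<in> interior D" by (simp add: m_def scaleR_add_right inverse_eq_divide)
      have mh: "m + h = x" "m - h = y"
        by (simp_all add: m_def h_def algebra_simps flip: scaleR_add_left)
      have xyD: "x \<in> D" "y \<in> D" "m \<in> D" using True m subsetD[OF interior_subset] by auto
      then have "W m < \<infinity>" by (simp add: D_def)
      from W_delta[OF this, of h]
      have "ereal (\<delta> (norm h)) \<le> W x + W y - 2 * W m" by (simp only: mh)
      also have "\<dots> = ereal (real_of_ereal (W x) + real_of_ereal (W y) - 2 * real_of_ereal (W m))"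
        by (subst (1 2 3) Wreal) (use xyD in auto)
      finally have "\<delta> (norm h) \<le> real_of_ereal (W x) + real_of_ereal (W y) - 2 * real_of_ereal (W m)" by simp
      moreover have "norm h = norm (x - y) / 2" by (simp add: h_def)
      ultimately have "- real_of_ereal (W x) - real_of_ereal (W y) + \<delta> (norm (x - y) / 2) \<le> 2 * (- real_of_ereal (W m))"
        by simp
      then show ?thesis
        using True m unfolding m_def[symmetric]
        by (simp add: g_def power2_eq_square flip: exp_add)
    qed (auto simp: g_def)
  qed (use delta_nonneg \<delta>_mono in auto)
  have \<nu>N: "measure \<nu> S = measure N S" if "S \<in> sets borel" for S
    using that by (simp add: measure_def em emeasure_N nn_integral_completion)
  have main: "gauss_enlarge (1 / 2 * sqrt (\<delta> (r / 8))) (measure \<nu> A) \<le> measure \<nu> (neighbourhood A r)"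
    if A: "A \<in> sets borel" and r: "0 < r" for A r
  proof -
    have d: "0 \<le> \<delta> (r / 8)" using r by (intro delta_nonneg) simp
    have nb: "neighbourhood A r \<in> sets \<nu>"
      unfolding \<nu>_sets by (rule neighbourhood_lebesgue[OF r])
    have "gauss_enlarge (1 / 2 * sqrt (\<delta> (r / 8))) (measure N A) \<le> measure \<nu> (neighbourhood A r)"
    proof (rule neighbourhood_enlargement[OF A r])
      \<comment> \<open>Every \<open>k \<ge> 0\<close> with
        \<open>k\<^sup>2 \<le> \<delta> (r / 8)\<close> is admissible; here the square is a quarter
        of that bound.\<close>
      show "0 \<le> 1 / 2 * sqrt (\<delta> (r / 8))" "(1 / 2 * sqrt (\<delta> (r / 8)))\<^sup>2 \<le> \<delta> (r / 8)"
        using d by (simp_all add: power_mult_distrib power2_eq_square)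
      fix C :: "(real ^ 'd) set" assume C: "compact C" "C \<subseteq> A"
      have "neighbourhood C r \<in> sets borel" using closed_neighbourhood_compact[OF C(1)] by simp
      then show "measure N (neighbourhood C r) \<le> measure \<nu> (neighbourhood A r)"
        using neighbourhood_mono[OF C(2)] nb by (simp add: \<nu>N[symmetric] \<nu>.finite_measure_mono)
    next
      have "measure \<nu> A \<le> measure \<nu> (neighbourhood A r)"
        using r by (intro \<nu>.finite_measure_mono nb subset_neighbourhood) simp
      then show "measure N A \<le> measure \<nu> (neighbourhood A r)" using A by (simp add: \<nu>N)
    qed
    then show ?thesis using A by (simp add: \<nu>N)
  qed
  show ?thesis
  proof (intro conjI ballI allI impI)
    fix A :: "(real ^ 'd) set" and r :: real assume "A \<in> sets borel" "0 < r"
    then show "std_normal_cdf (inv std_normal_cdf (measure \<nu> A) + ereal (1 / 2 * sqrt (\<delta> (r / 8))))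
        \<le> measure \<nu> (neighbourhood A r)"
      using main by (subst std_normal_cdf_shift) auto
  next
    fix A :: "(real ^ 'd) set" and r :: real assume A: "A \<in> sets borel" "1 / 2 \<le> measure \<nu> A" and r: "0 < r"
    let ?k = "1 / 2 * sqrt (\<delta> (r / 8))"
    have d: "0 \<le> \<delta> (r / 8)" using r by (intro delta_nonneg) simp
    \<comment> \<open>Half the square of \<open>?k\<close> is the exponent \<delta>(r/8)/8 of the
      claim.\<close>
    have "1 - 1 / 2 * exp (- (1 / 8) * \<delta> (r / 8)) = 1 - 1 / 2 * exp (- (?k\<^sup>2 / 2))"
      using d by (simp add: power_mult_distrib power_divide)
    also have "\<dots> \<le> gcdf ?k" using d by (intro gcdf_ge_exp) simp
    also have "\<dots> = gauss_enlarge ?k (1 / 2)"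
      using gauss_enlarge_gcdf[of ?k 0] by (simp add: gcdf_0)
    also have "\<dots> \<le> gauss_enlarge ?k (measure \<nu> A)"
      using A by (intro gauss_enlarge_mono) auto
    also have "\<dots> \<le> measure \<nu> (neighbourhood A r)" by (rule main[OF A(1) r])
    finally show "1 - 1 / 2 * exp (- (1 / 8) * \<delta> (r / 8)) \<le> measure \<nu> (neighbourhood A r)" .
  qed
qed

end
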